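(* Let $n>1$ be an odd integer. A $(K_2,K_{1,n})$-$URD(v;1,s)$ exists if and only if $v \equiv 2(n+1) \pmod{n(n+1)}$.
   Context: For graphs $H_1,H_2$, an $(H_1,H_2)$-$URD(v;r,s)$ is a decomposition of the edge set of the complete graph $K_v$ into edge-disjoint subgraphs (blocks), where the blocks are partitioned into $r+s$ classes, each class being a spanning collection of vertex-disjoint blocks (every vertex of $K_v$ lies in exactly one block of the class), such that $r$ classes consist only of copies of $H_1$ and $s$ classes consist only of copies of $H_2$. Here $K_2$ is a single edge (so a class of copies of $K_2$ is a 1-factor, i.e. a perfect matching) and $K_{1,n}$ is the star with $n$ edges ($n$-star). *)

theory Defs
  imports Main
begin

text \<open>Vertices of K_v are 0..v-1; an edge is a 2-element set of vertices;
  a block (subgraph) is given by its set of edges; its vertex set is the union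
  of its edges (copies of K_2 and of stars have no isolated vertices).\<close>

type_synonym edge = "nat set"
type_synonym block = "edge set"

definition Kv_edges :: "nat \<Rightarrow> edge set" where
  "Kv_edges v = {e. e \<subseteq> {..<v} \<and> card e = 2}"

definition block_verts :: "block \<Rightarrow> nat set" where
  "block_verts B = \<Union>B"

definition is_K2_copy :: "block \<Rightarrow> bool" where
  "is_K2_copy B \<longleftrightarrow> (\<exists>a b. a \<noteq> b \<and> B = {{a, b}})"

definition is_star_copy :: "nat \<Rightarrow> block \<Rightarrow> bool" where
  "is_star_copy n B \<longleftrightarrow>
     (\<exists>c L. c \<notin> L \<and> finite L \<and> card L = n \<and> B = (\<lambda>l. {c, l}) ` L)"

definition parallel_class :: "nat \<Rightarrow> block set \<Rightarrow> bool" where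
  "parallel_class v P \<longleftrightarrow>
     (\<forall>B\<in>P. B \<subseteq> Kv_edges v) \<and>
     (\<forall>x\<in>{..<v}. \<exists>!B. B \<in> P \<and> x \<in> block_verts B)"

definition URD :: "(block \<Rightarrow> bool) \<Rightarrow> (block \<Rightarrow> bool) \<Rightarrow> nat \<Rightarrow> nat \<Rightarrow> nat \<Rightarrow> bool" where
  "URD H1 H2 v r s \<longleftrightarrow>
     (\<exists>C :: nat \<Rightarrow> block set.
        (\<forall>i<r+s. parallel_class v (C i)) \<and>
        (\<forall>i<r. \<forall>B\<in>C i. H1 B) \<and>
        (\<forall>i. r \<le> i \<and> i < r+s \<longrightarrow> (\<forall>B\<in>C i. H2 B)) \<and>
        (\<forall>e\<in>Kv_edges v. \<exists>!p. fst p < r+s \<and> snd p \<in> C (fst p) \<and> e \<in> snd p))"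

end

theory Submission
  imports Defs
begin

text \<open>
  Necessity is counting: $n+1$ divides $v$, and comparing edges gives $(n+1)(v-2) = 2sn$.

  For sufficiency write $v = (n+1)m$ with $m = kn+2$ and take the points $(x,r)$ with column $x$
  in $Z_m$ and row $r$ in $Z_{n+1}$. One parallel class is developed modulo $m$. It consists of
  column stars from $(x,r)$ to points $(y,r)$, simultaneously for all rows $r$, whose column differences
  $y - x$ run through every difference up to sign, so that all edges inside the rows are used;
  the columns left over are covered by stars centred in row $0$. Between two rows $a$ and $b$ the
  unused edges then form $q_a + q_b$ perfect matchings $(x,a)$--$(x+d,b)$, one for each unused
  difference $d$. Giving $q_a$ of them to centres in row $a$ and $q_b$ to centres in row $b$, for
  every pair of rows, yields $q_a$ further classes whose centres are all points of row $a$.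

  If $k = 0$ the cyclic classes on $Z_{2(n+1)}$ do. If $k > 0$ is even, the 1-factor joins $(x,r)$ to $(x+m/2,r)$. If $k$ is odd, $m$ is odd and the
  1-factor joins row $r$ to row $r + (n+1)/2$; one column star then changes rows on
  $(n-1)/2$ of its leaves, which balances the row pairs not met by the 1-factor.
\<close>

section \<open>Star factors\<close>

lemma finite_Kv_edges: "finite (Kv_edges v)"
  unfolding Kv_edges_def by (rule finite_subset[of _ "Pow {..<v}"]) auto

lemma card_Kv_edges: "2 * card (Kv_edges v) = v * (v - 1)"
proof -
  have "card (Kv_edges v) = v choose 2"
    unfolding Kv_edges_def using n_subsets[of "{..<v}" 2] by simp
  moreover have "even (v * (v - 1))" by (cases v) auto
  ultimately show ?thesis by (simp add: choose_two)
qed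

text \<open>
  Only covering is assumed: the cardinality bounds force the stars of a class to be disjoint
  and each edge to be covered once.
\<close>

lemma star_factors_imp_URD_nat:
  fixes S :: "nat \<Rightarrow> (nat \<Rightarrow> nat) set" and f :: "nat \<Rightarrow> nat"
  assumes n: "n \<ge> 1" and v: "v = m * (n + 1)"
    and fin: "\<And>i. i \<in> {1..s} \<Longrightarrow> finite (S i)"
    and card: "\<And>i. i \<in> {1..s} \<Longrightarrow> card (S i) \<le> m"
    and range: "\<And>i g j. i \<in> {1..s} \<Longrightarrow> g \<in> S i \<Longrightarrow> j \<le> n \<Longrightarrow> g j < v"
    and cover: "\<And>i x. i \<in> {1..s} \<Longrightarrow> x < v \<Longrightarrow> \<exists>g\<in>S i. \<exists>j\<le>n. g j = x"
    and f: "\<And>x. x < v \<Longrightarrow> f x < v \<and> f x \<noteq> x \<and> f (f x) = x"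
    and edges: "\<And>x y. x < v \<Longrightarrow> y < v \<Longrightarrow> x \<noteq> y \<Longrightarrow>
       f x = y \<or> (\<exists>i\<in>{1..s}. \<exists>g\<in>S i. \<exists>j\<in>{1..n}. {x, y} = {g 0, g j})"
    and count: "2 * s * m * n + v \<le> v * (v - 1)"
  shows "URD is_K2_copy (is_star_copy n) v 1 s"
proof -
  define star where "star g = (\<lambda>j. {g 0, g j}) ` {1..n}" for g :: "nat \<Rightarrow> nat"
  define C where "C i = (if i = 0 then (\<lambda>x. {{x, f x}}) ` {..<v} else star ` S i)" for i
  \<comment> \<open>At most \<open>m * (n + 1) = v\<close> pairs of a star and a position must cover
    \<open>v\<close> points, so no point is hit twice. This one fact yields disjoint blocks,
    distinct leaves and distinct centres.\<close>
  have inj: "inj_on (\<lambda>(g, j). g j) (S i \<times> {..n})" if i: "i \<in> {1..s}" for i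
  proof (rule eq_card_imp_inj_on)
    show "finite (S i \<times> {..n})" using fin[OF i] by simp
    have "{..<v} \<subseteq> (\<lambda>(g, j). g j) ` (S i \<times> {..n})"
      using cover[OF i] by force
    then have "v \<le> card ((\<lambda>(g, j). g j) ` (S i \<times> {..n}))"
      by (metis card_lessThan card_mono fin[OF i] finite_SigmaI finite_atMost finite_imageI)
    moreover have "card ((\<lambda>(g, j). g j) ` (S i \<times> {..n})) \<le> card (S i \<times> {..n})"
      using fin[OF i] by (intro card_image_le) simp
    moreover have "card (S i \<times> {..n}) \<le> v"
      using card[OF i] v by (simp add: card_cartesian_product del: mult_Suc_right)
    ultimately show "card ((\<lambda>(g, j). g j) ` (S i \<times> {..n})) = card (S i \<times> {..n})" by linarith
  qed
  have injD: "g = g' \<and> j = j'"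
    if "i \<in> {1..s}" "g \<in> S i" "g' \<in> S i" "j \<le> n" "j' \<le> n" "g j = g' j'" for i g g' j j'
    using inj_onD[OF inj[OF that(1)], of "(g, j)" "(g', j')"] that by simp
  have verts: "block_verts (star g) = g ` {..n}" for g
  proof -
    have "{..n} = insert 0 {1..n}" by auto
    then have "g ` {..n} = insert (g 0) (g ` {1..n})" by (metis image_insert)
    moreover have "{1..n} \<noteq> {}" using n by simp
    then have "\<Union> (star g) = insert (g 0) (g ` {1..n})" unfolding star_def by auto
    ultimately show ?thesis unfolding block_verts_def by simp
  qed
  have star_copy: "is_star_copy n (star g)" if "i \<in> {1..s}" "g \<in> S i" for i g
  proof -
    have inj_g: "inj_on g {..n}" using injD[OF that(1,2,2)] by (auto intro!: inj_onI)
    have "card (g ` {1..n}) = n"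
      using card_image[OF inj_on_subset[OF inj_g, of "{1..n}"]] by (simp add: subset_iff)
    moreover have "g 0 \<notin> g ` {1..n}" using inj_onD[OF inj_g, of 0] by force
    ultimately show ?thesis unfolding is_star_copy_def star_def
      by (intro exI[of _ "g 0"] exI[of _ "g ` {1..n}"]) (auto simp: image_image)
  qed
  have star_edges: "{g 0, g j} \<in> Kv_edges v" if "i \<in> {1..s}" "g \<in> S i" "j \<in> {1..n}" for i g j
    using range[OF that(1,2), of 0] range[OF that(1,2), of j] injD[OF that(1,2,2), of 0 j] that(3)
    by (auto simp: Kv_edges_def card_2_iff)
  have par: "parallel_class v (C i)" if "i < 1 + s" for i
  proof (cases "i = 0")
    case True
    have "{x, f x} \<in> Kv_edges v" if "x < v" for x
      using f[OF that] that by (auto simp: Kv_edges_def card_2_iff)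
    moreover have "\<exists>!B. B \<in> C 0 \<and> x \<in> block_verts B" if "x < v" for x
    proof (rule ex1I[of _ "{{x, f x}}"])
      show "{{x, f x}} \<in> C 0 \<and> x \<in> block_verts {{x, f x}}"
        using that by (auto simp: C_def block_verts_def)
      show "B = {{x, f x}}" if "B \<in> C 0 \<and> x \<in> block_verts B" for B
        using that f by (auto simp: C_def block_verts_def)
    qed
    ultimately show ?thesis using True by (auto simp: parallel_class_def C_def)
  next
    case False
    then have i: "i \<in> {1..s}" using that by auto
    have "star g \<subseteq> Kv_edges v" if "g \<in> S i" for g
      using star_edges[OF i that] by (auto simp: star_def)
    moreover have "\<exists>!B. B \<in> C i \<and> x \<in> block_verts B" if xv: "x < v" for x
    proof -
      obtain g j where g: "g \<in> S i" "j \<le> n" "g j = x" using cover[OF i xv] by blast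
      show ?thesis
      proof (rule ex1I[of _ "star g"])
        show "star g \<in> C i \<and> x \<in> block_verts (star g)"
          using g False by (auto simp: C_def verts)
        show "B = star g" if B: "B \<in> C i \<and> x \<in> block_verts B" for B
        proof -
          obtain g' j' where g': "g' \<in> S i" "B = star g'" "j' \<le> n" "g' j' = x"
            using B False by (auto simp: C_def verts)
          then have "g' = g" using injD[OF i g'(1) g(1) g'(3) g(2)] g by simp
          then show ?thesis using g' by simp
        qed
      qed
    qed
    ultimately show ?thesis using False by (auto simp: parallel_class_def C_def)
  qed
  \<comment> \<open>\<open>A\<close> counts star edges with their origin (class, star, leaf).
    Injectivity of \<open>edge\<close> on \<open>A\<close> is what makes the covering block of an
    edge unique.\<close>
  define A where "A = (SIGMA i:{1..s}. S i \<times> {1..n})"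
  define edge where "edge = (\<lambda>(i :: nat, g :: nat \<Rightarrow> nat, j). {g 0, g j})"
  define F where "F = (\<lambda>x. {x, f x}) ` {..<v}"
  have finA: "finite A" using fin by (auto simp: A_def)
  have cardA: "card A \<le> s * m * n"
  proof -
    have "card A = (\<Sum>i\<in>{1..s}. card (S i) * n)"
      unfolding A_def using fin by (subst card_SigmaI) (auto simp: card_cartesian_product)
    also have "\<dots> \<le> (\<Sum>i\<in>{1..s}. m * n)" using card by (intro sum_mono mult_right_mono) auto
    finally show ?thesis by simp
  qed
  \<comment> \<open>Since \<open>f\<close> is an involution, two different edges of \<open>F\<close>
    are disjoint, so their ends are \<open>2 * card F\<close> distinct points.\<close>
  have cardF: "2 * card F \<le> v"
  proof -
    have "e \<inter> e' = {}" if "e \<in> F" "e' \<in> F" "e \<noteq> e'" for e e'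
    proof -
      obtain x y where xy: "x < v" "y < v" "e = {x, f x}" "e' = {y, f y}"
        using \<open>e \<in> F\<close> \<open>e' \<in> F\<close> by (auto simp: F_def)
      have ff: "f (f x) = x" "f (f y) = y" using f xy by blast+
      have "x \<noteq> y" using xy \<open>e \<noteq> e'\<close> by auto
      moreover have "x \<noteq> f y" using xy ff \<open>e \<noteq> e'\<close> by (metis insert_commute)
      moreover have "f x \<noteq> y" using xy ff \<open>e \<noteq> e'\<close> by (metis insert_commute)
      moreover have "f x \<noteq> f y" using ff \<open>x \<noteq> y\<close> by metis
      ultimately show ?thesis unfolding xy(3,4) by blast
    qed
    then have "card (\<Union>e\<in>F. e) = (\<Sum>e\<in>F. card e)"
      by (intro card_UN_disjoint) (auto simp: F_def)
    also have "\<dots> = (\<Sum>e\<in>F. 2)"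
      using f by (intro sum.cong) (auto simp: F_def card_2_iff)
    finally have "card (\<Union>e\<in>F. e) = 2 * card F" by simp
    moreover have "(\<Union>e\<in>F. e) \<subseteq> {..<v}" using f by (auto simp: F_def)
    then have "card (\<Union>e\<in>F. e) \<le> card {..<v}" by (rule card_mono[rotated]) simp
    ultimately show ?thesis by simp
  qed
  have sub: "Kv_edges v \<subseteq> F \<union> edge ` A"
  proof
    fix e assume "e \<in> Kv_edges v"
    then obtain x y where e: "e = {x, y}" "x \<noteq> y" "x < v" "y < v"
      by (auto simp: Kv_edges_def card_2_iff)
    from edges[OF e(3,4,2)] show "e \<in> F \<union> edge ` A"
    proof
      assume "f x = y" then show ?thesis using e by (auto simp: F_def)
    next
      assume "\<exists>i\<in>{1..s}. \<exists>g\<in>S i. \<exists>j\<in>{1..n}. {x, y} = {g 0, g j}"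
      then obtain i g j where "i \<in> {1..s}" "g \<in> S i" "j \<in> {1..n}" "e = {g 0, g j}" using e by blast
      then have "(i, g, j) \<in> A" "edge (i, g, j) = e" by (auto simp: A_def edge_def)
      then show ?thesis by blast
    qed
  qed
  have finF: "finite F" by (simp add: F_def)
  have le1: "card (Kv_edges v) \<le> card (F \<union> edge ` A)" using sub finF finA by (intro card_mono) auto
  have un: "card F + card (edge ` A) = card (F \<union> edge ` A) + card (F \<inter> edge ` A)"
    using finF finA by (intro card_Un_Int) auto
  have im: "card (edge ` A) \<le> card A" using finA by (rule card_image_le)
  have big: "2 * (s * m * n) + v \<le> 2 * card (Kv_edges v)" using count card_Kv_edges[of v] by (simp add: mult.assoc)
  have "card (edge ` A) = card A" "card (F \<inter> edge ` A) = 0"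
    using le1 un im big cardA cardF by linarith+
  then have edge_inj: "inj_on edge A" and disj: "F \<inter> edge ` A = {}"
    using finA finF by (auto intro: eq_card_imp_inj_on)
  have uniq: "\<exists>!p. fst p < 1 + s \<and> snd p \<in> C (fst p) \<and> e \<in> snd p" if e: "e \<in> Kv_edges v" for e
  proof -
    have cases: "(i = 0 \<and> B = {e} \<and> e \<in> F) \<or> (\<exists>g j. (i, g, j) \<in> A \<and> B = star g \<and> e = edge (i, g, j))"
      if iB: "i < 1 + s" "B \<in> C i" "e \<in> B" for i B
    proof (cases "i = 0")
      case True
      then show ?thesis using iB by (auto simp: C_def F_def)
    next
      case False
      then obtain g where g: "g \<in> S i" "B = star g" using iB by (auto simp: C_def)
      then obtain j where "j \<in> {1..n}" "e = {g 0, g j}" using iB by (auto simp: star_def)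
      then have "(i, g, j) \<in> A" "e = edge (i, g, j)"
        using g False iB by (auto simp: A_def edge_def)
      then show ?thesis using g by blast
    qed
    have "\<exists>p. fst p < 1 + s \<and> snd p \<in> C (fst p) \<and> e \<in> snd p"
    proof (cases "e \<in> F")
      case True
      then have "{e} \<in> C 0" by (auto simp: F_def C_def)
      then show ?thesis by (intro exI[of _ "(0, {e})"]) auto
    next
      case False
      then obtain a where "a \<in> A" "e = edge a" using sub e by blast
      then obtain i g j where "(i, g, j) \<in> A" "e = edge (i, g, j)" by (cases a) auto
      then show ?thesis
        by (intro exI[of _ "(i, star g)"]) (auto simp: A_def C_def edge_def star_def)
    qed
    moreover have "p = p'" if p: "fst p < 1 + s \<and> snd p \<in> C (fst p) \<and> e \<in> snd p"
      and p': "fst p' < 1 + s \<and> snd p' \<in> C (fst p') \<and> e \<in> snd p'" for p p'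
    proof -
      obtain i B i' B' where [simp]: "p = (i, B)" "p' = (i', B')" by (cases p, cases p')
      show ?thesis
      proof (cases "e \<in> F")
        case True
        then have "e \<notin> edge ` A" using disj by blast
        then show ?thesis using cases[of i B] cases[of i' B'] p p' by auto
      next
        case False
        obtain g j where gj: "(i, g, j) \<in> A" "B = star g" "e = edge (i, g, j)"
          using cases[of i B] p False by auto
        obtain g' j' where gj': "(i', g', j') \<in> A" "B' = star g'" "e = edge (i', g', j')"
          using cases[of i' B'] p' False by auto
        have "(i, g, j) = (i', g', j')"
          using inj_onD[OF edge_inj _ gj(1) gj'(1)] gj(3) gj'(3) by simp
        then show ?thesis using gj gj' by simp
      qed
    qed
    ultimately show ?thesis by blast
  qed
  show ?thesis unfolding URD_def
  proof (intro exI[of _ C] conjI allI impI ballI)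
    show "is_K2_copy B" if iB: "i < 1" "B \<in> C i" for i B
    proof -
      obtain x where "x < v" "B = {{x, f x}}" using iB by (auto simp: C_def)
      then show ?thesis using f unfolding is_K2_copy_def by metis
    qed
    show "is_star_copy n B" if "1 \<le> i \<and> i < 1 + s" "B \<in> C i" for i B
      using that star_copy[of i] by (auto simp: C_def)
    show "parallel_class v (C i)" if "i < 1 + s" for i by (rule par[OF that])
    show "\<exists>!p. fst p < 1 + s \<and> snd p \<in> C (fst p) \<and> e \<in> snd p" if "e \<in> Kv_edges v" for e
      by (rule uniq[OF that])
  qed
qed

text \<open>Transport along bijections to \<open>{..<card V}\<close> and \<open>{1..card I}\<close>;
  constructions can then use coordinates as points and a structured index set for the
  classes.\<close>

lemma star_factors_imp_URD:
  fixes V :: "'a set" and S :: "'i \<Rightarrow> (nat \<Rightarrow> 'a) set" and f :: "'a \<Rightarrow> 'a"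
  assumes n: "n \<ge> 1" and V: "finite V" "card V = m * (n + 1)" and I: "finite I"
    and fin: "\<And>i. i \<in> I \<Longrightarrow> finite (S i)"
    and card: "\<And>i. i \<in> I \<Longrightarrow> card (S i) \<le> m"
    and range: "\<And>i g j. i \<in> I \<Longrightarrow> g \<in> S i \<Longrightarrow> j \<le> n \<Longrightarrow> g j \<in> V"
    and cover: "\<And>i x. i \<in> I \<Longrightarrow> x \<in> V \<Longrightarrow> \<exists>g\<in>S i. \<exists>j\<le>n. g j = x"
    and f: "\<And>x. x \<in> V \<Longrightarrow> f x \<in> V \<and> f x \<noteq> x \<and> f (f x) = x"
    and edges: "\<And>x y. x \<in> V \<Longrightarrow> y \<in> V \<Longrightarrow> x \<noteq> y \<Longrightarrow>
       f x = y \<or> (\<exists>i\<in>I. \<exists>g\<in>S i. \<exists>j\<in>{1..n}. {x, y} = {g 0, g j})"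
    and count: "2 * card I * m * n + card V \<le> card V * (card V - 1)"
  shows "URD is_K2_copy (is_star_copy n) (card V) 1 (card I)"
proof -
  obtain b where b: "bij_betw b V {..<card V}"
    using ex_bij_betw_finite_nat[OF V(1)] by (auto simp: atLeast0LessThan)
  define b' where "b' = inv_into V b"
  have b': "bij_betw b' {..<card V} V" unfolding b'_def using b by (rule bij_betw_inv_into)
  have b'V: "b' x \<in> V" if "x < card V" for x using bij_betwE[OF b'] that by blast
  have bV: "b x < card V" if "x \<in> V" for x using bij_betwE[OF b] that by blast
  have bb': "b (b' x) = x" if "x < card V" for x
    unfolding b'_def using bij_betw_inv_into_right[OF b] that by simp
  have b'b: "b' (b x) = x" if "x \<in> V" for x
    unfolding b'_def using bij_betw_inv_into_left[OF b that] .
  obtain e where e: "bij_betw e {1..card I} I" using ex_bij_betw_nat_finite_1[OF I] by blast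
  have eI: "e i \<in> I" if "i \<in> {1..card I}" for i using bij_betwE[OF e] that by blast
  define S' where "S' i = (\<lambda>g. b \<circ> g) ` S (e i)" for i
  show ?thesis
  proof (rule star_factors_imp_URD_nat[where S = S' and f = "b \<circ> f \<circ> b'" and m = m])
    show "finite (S' i)" if "i \<in> {1..card I}" for i
      using fin[OF eI[OF that]] by (simp add: S'_def)
    show "card (S' i) \<le> m" if "i \<in> {1..card I}" for i
      unfolding S'_def using card_image_le[OF fin[OF eI[OF that]]] card[OF eI[OF that]]
      by (rule order_trans)
    show "g j < card V" if "i \<in> {1..card I}" "g \<in> S' i" "j \<le> n" for i g j
      using that range[OF eI[OF that(1)]] bV by (auto simp: S'_def)
    show "\<exists>g\<in>S' i. \<exists>j\<le>n. g j = x" if i: "i \<in> {1..card I}" and x: "x < card V" for i x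
    proof -
      obtain g j where "g \<in> S (e i)" "j \<le> n" "g j = b' x"
        using cover[OF eI[OF i] b'V[OF x]] by blast
      then have "b \<circ> g \<in> S' i" "(b \<circ> g) j = x" using bb'[OF x] by (auto simp: S'_def)
      then show ?thesis using \<open>j \<le> n\<close> by blast
    qed
    show "(b \<circ> f \<circ> b') x < card V \<and> (b \<circ> f \<circ> b') x \<noteq> x \<and> (b \<circ> f \<circ> b') ((b \<circ> f \<circ> b') x) = x"
      if x: "x < card V" for x
    proof -
      have fx: "f (b' x) \<in> V" "f (b' x) \<noteq> b' x" "f (f (b' x)) = b' x" using f[OF b'V[OF x]] by auto
      then show ?thesis using b'b[OF fx(1)] bb'[OF x] bV[OF fx(1)] by (metis comp_apply)
    qed
    show "(b \<circ> f \<circ> b') x = y \<or> (\<exists>i\<in>{1..card I}. \<exists>g\<in>S' i. \<exists>j\<in>{1..n}. {x, y} = {g 0, g j})"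
      if x: "x < card V" and y: "y < card V" and "x \<noteq> y" for x y
    proof -
      have "b' x \<noteq> b' y" using bb' x y \<open>x \<noteq> y\<close> by metis
      from edges[OF b'V[OF x] b'V[OF y] this] show ?thesis
      proof
        assume "f (b' x) = b' y"
        then show ?thesis using bb'[OF y] by simp
      next
        assume "\<exists>i\<in>I. \<exists>g\<in>S i. \<exists>j\<in>{1..n}. {b' x, b' y} = {g 0, g j}"
        then obtain i g j where g: "i \<in> I" "g \<in> S i" "j \<in> {1..n}" "{b' x, b' y} = {g 0, g j}"
          by blast
        have "b ` {b' x, b' y} = b ` {g 0, g j}" using g(4) by simp
        then have "{x, y} = {(b \<circ> g) 0, (b \<circ> g) j}" using bb' x y by simp
        moreover have "i \<in> e ` {1..card I}" using bij_betw_imp_surj_on[OF e] g(1) by simp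
        then obtain i' where i': "i = e i'" "i' \<in> {1..card I}" by (rule imageE)
        moreover have "b \<circ> g \<in> S' i'" using g(2) i'(1) by (simp add: S'_def)
        ultimately show ?thesis using g(3) by blast
      qed
    qed
  qed (use n V count in auto)
qed

section \<open>Necessity\<close>

lemma finite_parallel_class:
  assumes "parallel_class v P"
  shows "finite P"
proof (rule finite_subset)
  show "P \<subseteq> Pow (Kv_edges v)" using assms by (auto simp: parallel_class_def)
qed (simp add: finite_Kv_edges)

lemma parallel_class_card:
  assumes P: "parallel_class v P" and c: "\<And>B. B \<in> P \<Longrightarrow> card (block_verts B) = c"
  shows "v = c * card P"
proof -
  have sub: "block_verts B \<subseteq> {..<v}" if "B \<in> P" for B
    using P that unfolding parallel_class_def block_verts_def Kv_edges_def by blast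
  have "(\<Union>B\<in>P. block_verts B) = {..<v}"
    using P sub unfolding parallel_class_def by blast
  moreover have "card (\<Union>B\<in>P. block_verts B) = (\<Sum>B\<in>P. card (block_verts B))"
  proof (rule card_UN_disjoint)
    show "finite P" using P by (rule finite_parallel_class)
    show "\<forall>B\<in>P. finite (block_verts B)" using sub finite_subset by blast
    show "\<forall>B\<in>P. \<forall>B'\<in>P. B \<noteq> B' \<longrightarrow> block_verts B \<inter> block_verts B' = {}"
      using P sub unfolding parallel_class_def by blast
  qed
  ultimately show ?thesis using c by simp
qed

lemma K2_copy_card:
  assumes "is_K2_copy B"
  shows "card B = 1" "card (block_verts B) = 2"
  using assms by (auto simp: is_K2_copy_def block_verts_def)

lemma star_copy_card:
  assumes "is_star_copy n B" and "n \<ge> 1"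
  shows "card B = n" "card (block_verts B) = n + 1"
proof -
  obtain c L where L: "c \<notin> L" "finite L" "card L = n" "B = (\<lambda>l. {c, l}) ` L"
    using assms(1) by (auto simp: is_star_copy_def)
  have "inj_on (\<lambda>l. {c, l}) L" by (auto simp: inj_on_def doubleton_eq_iff)
  then show "card B = n" using L by (simp add: card_image)
  have "L \<noteq> {}" using L assms(2) by auto
  then have "block_verts B = insert c L" using L(4) by (auto simp: block_verts_def)
  then show "card (block_verts B) = n + 1" using L by simp
qed

text \<open>With \<open>u = v / (n + 1)\<close> stars per star class, counting edges gives
  \<open>v * (v - 1) = v + 2 * s * u * n\<close>; cancelling \<open>v\<close> and then
  \<open>u\<close> leaves the stated equation.\<close>

lemma URD_count:
  assumes U: "URD is_K2_copy (is_star_copy n) v 1 s" and n: "n \<ge> 1" and v: "v \<ge> 1" and s: "s \<ge> 1"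
  shows "even v" "n + 1 dvd v" "(n + 1) * (v - 2) = 2 * s * n"
proof -
  obtain C where par: "\<And>i. i < 1 + s \<Longrightarrow> parallel_class v (C i)"
    and K2: "\<And>B. B \<in> C 0 \<Longrightarrow> is_K2_copy B"
    and star: "\<And>i B. 1 \<le> i \<Longrightarrow> i < 1 + s \<Longrightarrow> B \<in> C i \<Longrightarrow> is_star_copy n B"
    and uniq: "\<And>e. e \<in> Kv_edges v \<Longrightarrow> \<exists>!p. fst p < 1 + s \<and> snd p \<in> C (fst p) \<and> e \<in> snd p"
  proof -
    from U obtain C where "\<forall>i<1 + s. parallel_class v (C i)" "\<forall>i<1. \<forall>B\<in>C i. is_K2_copy B"
      "\<forall>i. 1 \<le> i \<and> i < 1 + s \<longrightarrow> (\<forall>B\<in>C i. is_star_copy n B)"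
      "\<forall>e\<in>Kv_edges v. \<exists>!p. fst p < 1 + s \<and> snd p \<in> C (fst p) \<and> e \<in> snd p"
      unfolding URD_def by (elim exE conjE)
    then show ?thesis by (intro that[of C]) simp_all
  qed
  have v2: "v = 2 * card (C 0)"
    by (rule parallel_class_card[OF par]) (simp_all add: K2_copy_card(2) K2)
  have vn: "v = (n + 1) * card (C i)" if "i \<in> {1..s}" for i
    using that by (intro parallel_class_card[OF par] star_copy_card(2)[OF star n]) auto
  show "even v" using v2 by simp
  show dvd: "n + 1 dvd v" using vn[of 1] s by (metis atLeastAtMost_iff dvd_triv_left order_refl)
  obtain u where u: "v = (n + 1) * u" using dvd by auto
  have cu: "card (C i) = u" if "i \<in> {1..s}" for i
    using vn[OF that] u by (metis add_is_0 mult_left_cancel zero_neq_one)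
  \<comment> \<open>Blocks are tagged by their class. Unique existence of the pair (class, block)
    then says exactly that the tagged blocks are pairwise edge-disjoint.\<close>
  define T where "T = (SIGMA i:{..s}. C i)"
  have finC: "finite (C i)" if "i \<le> s" for i using finite_parallel_class[OF par] that by simp
  have blocks: "B \<subseteq> Kv_edges v" if "i \<le> s" "B \<in> C i" for i B
    using par[of i] that by (auto simp: parallel_class_def)
  have "(\<Union>p\<in>T. snd p) = Kv_edges v"
  proof
    show "(\<Union>p\<in>T. snd p) \<subseteq> Kv_edges v" using blocks unfolding T_def by fastforce
    show "Kv_edges v \<subseteq> (\<Union>p\<in>T. snd p)"
    proof
      fix e assume "e \<in> Kv_edges v"
      then obtain p where "fst p < 1 + s" "snd p \<in> C (fst p)" "e \<in> snd p" using uniq by blast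
      then show "e \<in> (\<Union>p\<in>T. snd p)" by (auto simp: T_def intro!: bexI[of _ p])
    qed
  qed
  moreover have "card (\<Union>p\<in>T. snd p) = (\<Sum>p\<in>T. card (snd p))"
  proof (rule card_UN_disjoint)
    show "finite T" using finC by (auto simp: T_def)
    show "\<forall>p\<in>T. finite (snd p)" using blocks finite_Kv_edges finite_subset by (fastforce simp: T_def)
    show "\<forall>p\<in>T. \<forall>p'\<in>T. p \<noteq> p' \<longrightarrow> snd p \<inter> snd p' = {}"
    proof (intro ballI impI, rule ccontr)
      fix p p' assume p: "p \<in> T" "p' \<in> T" "p \<noteq> p'" "snd p \<inter> snd p' \<noteq> {}"
      then obtain e where e: "e \<in> snd p" "e \<in> snd p'" by blast
      have T: "fst p < 1 + s \<and> snd p \<in> C (fst p)" "fst p' < 1 + s \<and> snd p' \<in> C (fst p')"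
        using p by (auto simp: T_def)
      then have "e \<in> Kv_edges v" using blocks[of "fst p" "snd p"] e by auto
      then show False using uniq[of e] T e p(3) by blast
    qed
  qed
  moreover have "(\<Sum>p\<in>T. card (snd p)) = (\<Sum>i\<in>{..s}. \<Sum>B\<in>C i. card B)"
    unfolding T_def using finC by (subst sum.Sigma) (auto simp: case_prod_unfold)
  moreover have "(\<Sum>i\<in>{..s}. \<Sum>B\<in>C i. card B) = card (C 0) + s * (u * n)"
  proof -
    have "{..s} = insert 0 {1..s}" by auto
    then have "(\<Sum>i\<in>{..s}. \<Sum>B\<in>C i. card B) = (\<Sum>B\<in>C 0. card B) + (\<Sum>i\<in>{1..s}. \<Sum>B\<in>C i. card B)"
      by simp
    also have "(\<Sum>B\<in>C 0. card B) = card (C 0)" using K2_copy_card(1)[OF K2] by simp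
    also have "(\<Sum>i\<in>{1..s}. \<Sum>B\<in>C i. card B) = (\<Sum>i\<in>{1..s}. u * n)"
      using star_copy_card(1)[OF star n] cu by (intro sum.cong) auto
    finally show ?thesis by simp
  qed
  ultimately have "card (Kv_edges v) = card (C 0) + s * (u * n)" by simp
  then have "v * (v - 1) = v + 2 * (s * (u * n))" using card_Kv_edges[of v] v2 by simp
  \<comment> \<open>Evenness and \<open>v \<ge> 1\<close> give \<open>v \<ge> 2\<close>, so the
    subtraction of naturals is exact.\<close>
  moreover have "v * (v - 1) = v + v * (v - 2)"
  proof -
    have "v \<ge> 2" using v v2 by presburger
    then obtain w where "v = w + 2" by (metis add.commute le_Suc_ex)
    then show ?thesis by (simp add: algebra_simps)
  qed
  ultimately have "v * (v - 2) = 2 * (s * (u * n))" by simp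
  moreover have "v * (v - 2) = u * ((n + 1) * (v - 2))" by (subst u) (simp only: mult.commute mult.left_commute)
  ultimately have "u * ((n + 1) * (v - 2)) = u * (2 * s * n)" by (simp only: mult.assoc mult.left_commute)
  moreover have "u > 0" using u v by (cases u) auto
  ultimately show "(n + 1) * (v - 2) = 2 * s * n" by simp
qed

text \<open>As \<open>n\<close> is coprime to \<open>n + 1\<close>, the edge count forces
  \<open>n\<close> to divide \<open>v - 2\<close>, hence also \<open>v - 2 * (n + 1)\<close>. The
  latter is divisible by \<open>n + 1\<close> as well, and coprime divisors multiply. Integers avoid
  truncated subtraction.\<close>

lemma URD_imp_mod:
  assumes U: "URD is_K2_copy (is_star_copy n) v 1 s" and n: "n \<ge> 1" and v: "v \<ge> 1" and s: "s \<ge> 1"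
  shows "v mod (n * (n + 1)) = (2 * (n + 1)) mod (n * (n + 1))"
proof -
  note c = URD_count[OF assms]
  have v2: "v \<ge> 2" using c(1) v by (cases "v = 1") auto
  have cop: "coprime n (n + 1)" by simp
  have "n dvd v - 2" using c(3) cop by (metis coprime_dvd_mult_right_iff dvd_triv_right)
  then have "int n dvd int v - 2" using v2 by (metis int_dvd_int_iff of_nat_diff of_nat_numeral)
  then have 1: "int n dvd int v - int (2 * (n + 1))"
    using dvd_diff[of "int n" "int v - 2" "2 * int n"] by (simp add: algebra_simps)
  have "int (n + 1) dvd int v" "int (n + 1) dvd int (2 * (n + 1))"
    using c(2) by (simp_all only: int_dvd_int_iff dvd_triv_right)
  then have 2: "int (n + 1) dvd int v - int (2 * (n + 1))" by (rule dvd_diff)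
  have "coprime (int n) (int (n + 1))" using cop by (simp only: coprime_int_iff)
  then have "int n * int (n + 1) dvd int v - int (2 * (n + 1))" using 1 2 by (intro divides_mult)
  then have "int v mod (int n * int (n + 1)) = int (2 * (n + 1)) mod (int n * int (n + 1))"
    by (simp only: mod_eq_dvd_iff)
  then show ?thesis by (metis of_nat_eq_iff of_nat_mod of_nat_mult)
qed

section \<open>Development modulo the number of columns\<close>

text \<open>These are the pure (\<open>a = b\<close>) and mixed differences of the method of
  differences, measured from row \<open>a\<close> to row \<open>b\<close> whichever end is the
  centre. They stay unreduced integers; congruence modulo \<open>m\<close> enters only where they
  are used.\<close>

definition base_diff :: "(nat \<Rightarrow> int \<times> int) set \<Rightarrow> nat \<Rightarrow> int \<Rightarrow> int \<Rightarrow> int \<Rightarrow> bool" where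
  "base_diff P n a b d \<longleftrightarrow> (\<exists>g\<in>P. \<exists>j\<in>{1..n}.
     (snd (g 0) = a \<and> snd (g j) = b \<and> d = fst (g j) - fst (g 0)) \<or>
     (snd (g 0) = b \<and> snd (g j) = a \<and> d = fst (g 0) - fst (g j)))"

text \<open>Two integers in the open interval from \<open>- M / 2\<close> to \<open>M / 2\<close>
  differ by less than \<open>M\<close>. Thus distinct residues can be counted by counting small
  integers.\<close>

lemma card_image_mod:
  fixes T :: "int set"
  assumes "\<And>d. d \<in> T \<Longrightarrow> 2 * \<bar>d\<bar> < M"
  shows "card ((\<lambda>d. d mod M) ` T) = card T"
proof (rule card_image, rule inj_onI)
  fix c d assume cd: "c \<in> T" "d \<in> T" "c mod M = d mod M"
  then have "M dvd c - d" by (simp add: mod_eq_dvd_iff)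
  moreover have "\<bar>c - d\<bar> < \<bar>M\<bar>" using assms[OF cd(1)] assms[OF cd(2)] by linarith
  ultimately show "c = d" using dvd_imp_le_int[of "c - d" M] by linarith
qed

lemma finite_subset_image_lessThan:
  assumes "finite A" and "card A \<le> N"
  shows "\<exists>f :: nat \<Rightarrow> 'a. A \<subseteq> f ` {..<N}"
proof -
  obtain f where "bij_betw f {0..<card A} A" using ex_bij_betw_nat_finite[OF assms(1)] by blast
  then have "A = f ` {0..<card A}" by (simp add: bij_betw_def)
  also have "\<dots> \<subseteq> f ` {..<N}" using assms(2) by auto
  finally show ?thesis by blast
qed

text \<open>
  The set $P$ is the class to be developed, the 1-factor joins $(x,r)$ to
  $(x + \<phi> r, \<rho> r)$, and $q_a$ is the number of classes centred on row $a$.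
\<close>

lemma developed_URD:
  fixes m n :: nat and P :: "(nat \<Rightarrow> int \<times> int) set" and \<rho> \<phi> :: "int \<Rightarrow> int" and q :: "int \<Rightarrow> nat"
  defines "diff a b d \<equiv> base_diff P n a b d \<or> (\<rho> a = b \<and> d = \<phi> a)"
  assumes m: "m > 0" and n: "n \<ge> 1" and P: "finite P" "card P \<le> m"
    and rows: "\<And>g j. g \<in> P \<Longrightarrow> j \<le> n \<Longrightarrow> snd (g j) \<in> {0..int n}"
    and cover: "\<And>x r. r \<in> {0..int n} \<Longrightarrow> \<exists>g\<in>P. \<exists>j\<le>n. snd (g j) = r \<and> int m dvd fst (g j) - x"
    and F: "\<And>r. r \<in> {0..int n} \<Longrightarrow> \<rho> r \<in> {0..int n} \<and> \<rho> (\<rho> r) = r \<and>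
              int m dvd \<phi> r + \<phi> (\<rho> r) \<and> (\<rho> r = r \<longrightarrow> \<not> int m dvd \<phi> r)"
    and pure: "\<And>a d. a \<in> {0..int n} \<Longrightarrow> 0 < d \<Longrightarrow> d < int m \<Longrightarrow> \<exists>d'. int m dvd d' - d \<and> diff a a d'"
    and mixed: "\<And>a b. 0 \<le> a \<Longrightarrow> a < b \<Longrightarrow> b \<le> int n \<Longrightarrow>
       \<exists>T. finite T \<and> (\<forall>d\<in>T. 2 * \<bar>d\<bar> < int m \<and> diff a b d) \<and> m \<le> card T + q a + q b"
    and count: "2 * (m + (\<Sum>a\<in>{0..int n}. q a)) * n + 2 * (n + 1) \<le> (n + 1) * (m * (n + 1))"
  shows "URD is_K2_copy (is_star_copy n) (m * (n + 1)) 1 (m + (\<Sum>a\<in>{0..int n}. q a))"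
proof -
  define M where "M = int m"
  define N where "N = int n + 1"
  have M: "M > 0" and N: "N > 0" using m by (auto simp: M_def N_def)
  have N_rows: "{0..int n} = {0..<N}" by (auto simp: N_def)
  define V where "V = {0..<M} \<times> {0..int n}"
  have V: "finite V" "card V = m * (n + 1)"
    by (simp_all add: V_def M_def card_cartesian_product nat_add_distrib)
  \<comment> \<open>For rows \<open>a < b\<close>, list the residues that neither the base class nor
    the 1-factor is known to realise. The set \<open>T\<close> from \<open>mixed\<close> leaves at
    most \<open>q a + q b\<close> of them.\<close>
  have "\<exists>f :: nat \<Rightarrow> int. 0 \<le> a \<and> a < b \<and> b \<le> int n \<longrightarrow>
      (\<forall>d. 0 \<le> d \<and> d < M \<longrightarrow> (\<exists>d'. M dvd d' - d \<and> diff a b d') \<or> d \<in> f ` {..<q a + q b})" for a b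
  proof (cases "0 \<le> a \<and> a < b \<and> b \<le> int n")
    case True
    then obtain T where T: "finite T" "\<And>d. d \<in> T \<Longrightarrow> 2 * \<bar>d\<bar> < M" "\<And>d. d \<in> T \<Longrightarrow> diff a b d"
      "m \<le> card T + q a + q b" using mixed[of a b] M_def by blast
    let ?T = "(\<lambda>d. d mod M) ` T"
    have "card ({0..<M} - ?T) = card {0..<M} - card ?T"
      using T(1) M by (intro card_Diff_subset) auto
    then have "card ({0..<M} - ?T) \<le> q a + q b"
      using T(4) card_image_mod[OF T(2)] by (simp add: M_def)
    then obtain f :: "nat \<Rightarrow> int" where f: "{0..<M} - ?T \<subseteq> f ` {..<q a + q b}"
      using finite_subset_image_lessThan by (metis finite_Diff finite_atLeastLessThan_int)
    have "(\<exists>d'. M dvd d' - d \<and> diff a b d') \<or> d \<in> f ` {..<q a + q b}" if d: "0 \<le> d \<and> d < M" for d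
    proof (cases "d \<in> ?T")
      case True
      then obtain d' where d': "d' \<in> T" "d = d' mod M" by blast
      then have "M dvd d' - d" by (simp add: mod_eq_dvd_iff[symmetric])
      then show ?thesis using T(3) d' by blast
    next
      case False
      then show ?thesis using f d by auto
    qed
    then show ?thesis by blast
  qed auto
  then obtain f :: "int \<Rightarrow> int \<Rightarrow> nat \<Rightarrow> int" where
    f: "\<And>a b d. 0 \<le> a \<Longrightarrow> a < b \<Longrightarrow> b \<le> int n \<Longrightarrow> 0 \<le> d \<Longrightarrow> d < M \<Longrightarrow>
       (\<exists>d'. M dvd d' - d \<and> diff a b d') \<or> d \<in> f a b ` {..<q a + q b}" by metis
  \<comment> \<open>The list of a pair is split: its first entries belong to centres in the smaller
    row, the rest to the larger row. Hence the offset \<open>q b\<close>, and the sign because the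
    difference is then read backwards.\<close>
  define \<delta> where "\<delta> a b i = (if a < b then f a b i else - f b a (q b + i))" for a b i
  define I where "I = (Inl ` {0..<M} \<union> Inr ` (SIGMA a:{0..int n}. {..<q a}) :: (int + int \<times> nat) set)"
  define shift where "shift t g = (\<lambda>j. ((fst (g j) + t) mod M, snd (g j)))"
    for t and g :: "nat \<Rightarrow> int \<times> int"
  \<comment> \<open>Leaf \<open>j\<close> lies in row \<open>a + j\<close> modulo \<open>N\<close>,
    so the leaves meet each other row once; letting the centre \<open>x\<close> vary translates the
    whole star and fills every row.\<close>
  define row where "row a i x = (\<lambda>j. if j = 0 then (x, a) else
      ((x + \<delta> a ((a + int j) mod N) i) mod M, (a + int j) mod N))" for a i x
  define S where "S = case_sum (\<lambda>t. shift t ` P) (\<lambda>(a, i). row a i ` {0..<M})"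
  define \<Phi> where "\<Phi> = (\<lambda>(x, r). ((x + \<phi> r) mod M, \<rho> r))"
  have cardI: "card I = m + (\<Sum>a\<in>{0..int n}. q a)"
  proof -
    have "card I = card (Inl ` {0..<M} :: (int + int \<times> nat) set) +
        card (Inr ` (SIGMA a:{0..int n}. {..<q a}) :: (int + int \<times> nat) set)"
      unfolding I_def by (intro card_Un_disjoint) auto
    then show ?thesis by (simp add: card_image M_def)
  qed
  have base_edge: "\<exists>i\<in>I. \<exists>g\<in>S i. \<exists>j\<in>{1..n}. {(x, a), (y, b)} = {g 0, g j}"
    if x: "0 \<le> x" "x < M" and y: "0 \<le> y" "y < M" and d: "M dvd d - (y - x)" "base_diff P n a b d"
    for x y a b d
  proof -
    \<comment> \<open>The translate by \<open>x - X\<close> carries the base edge with columns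
      \<open>X\<close> and \<open>Y\<close> to the wanted edge.\<close>
    have edge: "(X + (x - X) mod M) mod M = x" "(Y + (x - X) mod M) mod M = y" if "d = Y - X" for X Y
    proof -
      show "(X + (x - X) mod M) mod M = x" using x by (simp add: mod_add_right_eq)
      have "(Y + (x - X) mod M) mod M = (Y + (x - X)) mod M" by (simp add: mod_add_right_eq)
      also have "\<dots> = y mod M" using d(1) that by (simp add: mod_eq_dvd_iff algebra_simps)
      finally show "(Y + (x - X) mod M) mod M = y" using y by simp
    qed
    from d(2) obtain g j where g: "g \<in> P" "j \<in> {1..n}" and
      "(snd (g 0) = a \<and> snd (g j) = b \<and> d = fst (g j) - fst (g 0)) \<or>
       (snd (g 0) = b \<and> snd (g j) = a \<and> d = fst (g 0) - fst (g j))"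
      unfolding base_diff_def by blast
    then show ?thesis
    proof (elim disjE conjE)
      assume "snd (g 0) = a" "snd (g j) = b" and dd: "d = fst (g j) - fst (g 0)"
      then have "{(x, a), (y, b)} = {shift ((x - fst (g 0)) mod M) g 0, shift ((x - fst (g 0)) mod M) g j}"
        using edge[OF dd] by (simp add: shift_def)
      moreover have "shift ((x - fst (g 0)) mod M) g \<in> S (Inl ((x - fst (g 0)) mod M))"
        using g by (simp add: S_def)
      moreover have "Inl ((x - fst (g 0)) mod M) \<in> I" using M by (simp add: I_def)
      ultimately show ?thesis using g(2) by blast
    next
      assume "snd (g 0) = b" "snd (g j) = a" and dd: "d = fst (g 0) - fst (g j)"
      then have "{(x, a), (y, b)} = {shift ((x - fst (g j)) mod M) g 0, shift ((x - fst (g j)) mod M) g j}"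
        using edge[OF dd] by (simp add: shift_def insert_commute)
      moreover have "shift ((x - fst (g j)) mod M) g \<in> S (Inl ((x - fst (g j)) mod M))"
        using g by (simp add: S_def)
      moreover have "Inl ((x - fst (g j)) mod M) \<in> I" using M by (simp add: I_def)
      ultimately show ?thesis using g(2) by blast
    qed
  qed
  have diff_edge: "\<Phi> (x, a) = (y, b) \<or> (\<exists>i\<in>I. \<exists>g\<in>S i. \<exists>j\<in>{1..n}. {(x, a), (y, b)} = {g 0, g j})"
    if x: "0 \<le> x" "x < M" and y: "0 \<le> y" "y < M" and d: "M dvd d - (y - x)" "diff a b d"
    for x y a b d
  proof (cases "base_diff P n a b d")
    case True
    then show ?thesis using base_edge[OF x y d(1)] by blast
  next
    case False
    then have "\<rho> a = b" "d = \<phi> a" using d(2) by (auto simp: diff_def)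
    moreover have "(x + d) mod M = y mod M" using d(1) by (simp add: mod_eq_dvd_iff algebra_simps)
    ultimately show ?thesis using y by (simp add: \<Phi>_def)
  qed
  have row_edge: "\<exists>i\<in>I. \<exists>g\<in>S i. \<exists>j\<in>{1..n}. {(x, a), (y, b)} = {g 0, g j}"
    if x: "0 \<le> x" "x < M" and y: "0 \<le> y" "y < M" and a: "a \<in> {0..int n}" and b: "b \<in> {0..int n}"
      and ab: "a \<noteq> b" and i: "i < q a" and d: "M dvd \<delta> a b i - (y - x)"
    for x y a b i
  proof -
    \<comment> \<open>This is the number of the leaf in row \<open>b\<close>; it is nonzero because
      the rows differ.\<close>
    define j where "j = nat ((b - a) mod N)"
    have j: "int j = (b - a) mod N" using N by (simp add: j_def)
    have "(b - a) mod N \<noteq> 0"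
    proof
      assume "(b - a) mod N = 0"
      then have "N dvd b - a" by auto
      then show False using dvd_imp_le_int[of "b - a" N] a b ab by (auto simp: N_def)
    qed
    moreover have "(b - a) mod N < N" "(b - a) mod N \<ge> 0" using N by simp_all
    ultimately have jn: "j \<in> {1..n}" using j by (auto simp: N_def)
    have "(a + int j) mod N = b" unfolding j using b by (simp add: mod_add_right_eq N_def)
    moreover have "(x + \<delta> a b i) mod M = y mod M" using d by (simp add: mod_eq_dvd_iff algebra_simps)
    ultimately have "{(x, a), (y, b)} = {row a i x 0, row a i x j}"
      using jn y by (simp add: row_def)
    moreover have "row a i x \<in> S (Inr (a, i))" using x by (simp add: S_def)
    moreover have "Inr (a, i) \<in> I" using a i by (auto simp: I_def)
    ultimately show ?thesis using jn by blast
  qed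
  have mixed_edge: "\<Phi> (x, a) = (y, b) \<or> (\<exists>i\<in>I. \<exists>g\<in>S i. \<exists>j\<in>{1..n}. {(x, a), (y, b)} = {g 0, g j})"
    if x: "0 \<le> x" "x < M" and y: "0 \<le> y" "y < M" and ab: "0 \<le> a" "a < b" "b \<le> int n"
    for x y a b
  proof -
    have "0 \<le> (y - x) mod M" "(y - x) mod M < M" using M by simp_all
    from f[OF ab this] show ?thesis
    proof
      assume "\<exists>d'. M dvd d' - (y - x) mod M \<and> diff a b d'"
      then obtain d' where d': "M dvd d' - (y - x) mod M" "diff a b d'" by blast
      have "M dvd d' - (y - x)" using d'(1) by (metis mod_eq_dvd_iff mod_mod_trivial)
      then show ?thesis using diff_edge[OF x y _ d'(2)] by blast
    next
      assume "(y - x) mod M \<in> f a b ` {..<q a + q b}"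
      then obtain i where i: "i < q a + q b" "(y - x) mod M = f a b i" by auto
      have fd: "M dvd f a b i - (y - x)" using i(2) by (metis mod_eq_dvd_iff mod_mod_trivial)
      show ?thesis
      proof (cases "i < q a")
        case True
        have "\<delta> a b i = f a b i" using ab by (simp add: \<delta>_def)
        then show ?thesis using row_edge[OF x y _ _ _ True, of b] fd ab by auto
      next
        case False
        \<comment> \<open>Entries from \<open>q a\<close> onwards are served by stars centred in row
          \<open>b\<close>, so the roles of the two ends are exchanged.\<close>
        have "\<delta> b a (i - q a) = - f a b i" using ab False by (simp add: \<delta>_def)
        moreover have "- f a b i - (x - y) = - (f a b i - (y - x))" by simp
        ultimately have "M dvd \<delta> b a (i - q a) - (x - y)" using fd by (metis dvd_minus_iff)
        moreover have "i - q a < q b" using i False by simp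
        ultimately have "\<exists>i\<in>I. \<exists>g\<in>S i. \<exists>j\<in>{1..n}. {(y, b), (x, a)} = {g 0, g j}"
          using row_edge[OF y x, of b a "i - q a"] ab by auto
        then show ?thesis by (simp add: insert_commute)
      qed
    qed
  qed
  have \<Phi>: "\<Phi> u \<in> V \<and> \<Phi> u \<noteq> u \<and> \<Phi> (\<Phi> u) = u" if uV: "u \<in> V" for u
  proof -
    obtain x r where u: "u = (x, r)" "0 \<le> x" "x < M" "r \<in> {0..int n}" using uV by (auto simp: V_def)
    note Fr = F[OF u(4), folded M_def]
    have "((x + \<phi> r) mod M + \<phi> (\<rho> r)) mod M = (x + (\<phi> r + \<phi> (\<rho> r))) mod M"
      by (simp add: mod_add_left_eq add.assoc)
    also have "\<dots> = x" using Fr u by (auto elim!: dvdE)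
    finally have inv: "\<Phi> (\<Phi> u) = u" using Fr by (simp add: \<Phi>_def u)
    have "\<Phi> u \<noteq> u"
    proof
      assume "\<Phi> u = u"
      then have "(x + \<phi> r) mod M = x mod M" "\<rho> r = r" using u by (auto simp: \<Phi>_def)
      then show False using Fr by (simp add: mod_eq_dvd_iff)
    qed
    then show ?thesis using inv Fr M u by (auto simp: \<Phi>_def V_def)
  qed
  have "URD is_K2_copy (is_star_copy n) (card V) 1 (card I)"
  proof (rule star_factors_imp_URD[where S = S and f = \<Phi> and m = m])
    show "n \<ge> 1" "finite V" "card V = m * (n + 1)" by (fact n V)+
    show "finite I" by (simp add: I_def)
    show "finite (S i)" if "i \<in> I" for i using that P by (auto simp: I_def S_def)
    show "card (S i) \<le> m" if "i \<in> I" for i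
    proof (cases i)
      case (Inl t)
      then show ?thesis using card_image_le[OF P(1), of "shift t"] P(2) by (simp add: S_def)
    next
      case (Inr p)
      then show ?thesis using card_image_le[of "{0..<M}" "row (fst p) (snd p)"]
        by (simp add: S_def case_prod_unfold M_def)
    qed
    show "g j \<in> V" if "i \<in> I" "g \<in> S i" "j \<le> n" for i g j
      using that M rows unfolding I_def S_def V_def
      by (auto simp: shift_def row_def N_rows)
    show "\<exists>g\<in>S i. \<exists>j\<le>n. g j = u" if i: "i \<in> I" and u: "u \<in> V" for i u
    proof -
      obtain y b where y: "u = (y, b)" "0 \<le> y" "y < M" "b \<in> {0..int n}" using u by (auto simp: V_def)
      show ?thesis
      proof (cases i)
        case (Inl t)
        obtain g j where g: "g \<in> P" "j \<le> n" "snd (g j) = b" "M dvd fst (g j) - (y - t)"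
          using cover[OF y(4), of "y - t"] by (auto simp: M_def)
        have "(fst (g j) + t) mod M = y mod M" using g(4) by (simp add: mod_eq_dvd_iff algebra_simps)
        then have "shift t g j = u" using g y by (simp add: shift_def)
        moreover have "shift t g \<in> S i" using Inl g by (simp add: S_def)
        ultimately show ?thesis using g(2) by blast
      next
        case (Inr p)
        then obtain a k where p: "i = Inr (a, k)" "a \<in> {0..int n}" "k < q a" using i by (auto simp: I_def)
        define j where "j = nat ((b - a) mod N)"
        have j: "int j = (b - a) mod N" using N by (simp add: j_def)
        have jn: "j \<le> n" using pos_mod_bound[OF N, of "b - a"] j by (simp add: N_def)
        have b: "(a + int j) mod N = b" unfolding j using y(4) by (simp add: mod_add_right_eq N_def)
        show ?thesis
        proof (cases "j = 0")
          case True
          then have "row a k y 0 = u" using b p(2) y by (simp add: row_def N_def)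
          moreover have "row a k y \<in> S i" using p y by (simp add: S_def)
          ultimately show ?thesis by blast
        next
          case False
          have "((y - \<delta> a b k) mod M + \<delta> a b k) mod M = y" using y by (simp add: mod_add_left_eq)
          then have "row a k ((y - \<delta> a b k) mod M) j = u" using b y False by (simp add: row_def)
          moreover have "row a k ((y - \<delta> a b k) mod M) \<in> S i" using p M by (simp add: S_def)
          ultimately show ?thesis using jn by blast
        qed
      qed
    qed
    show "\<Phi> u \<in> V \<and> \<Phi> u \<noteq> u \<and> \<Phi> (\<Phi> u) = u" if "u \<in> V" for u using \<Phi>[OF that] .
    show "\<Phi> u = w \<or> (\<exists>i\<in>I. \<exists>g\<in>S i. \<exists>j\<in>{1..n}. {u, w} = {g 0, g j})"
      if uV: "u \<in> V" and wV: "w \<in> V" and uw: "u \<noteq> w" for u w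
    proof -
      obtain x a where u: "u = (x, a)" "0 \<le> x" "x < M" "0 \<le> a" "a \<le> int n" using uV by (auto simp: V_def)
      obtain y b where w: "w = (y, b)" "0 \<le> y" "y < M" "0 \<le> b" "b \<le> int n" using wV by (auto simp: V_def)
      consider "a < b" | "b < a" | "a = b" by linarith
      then show ?thesis
      proof cases
        case 1
        then show ?thesis using mixed_edge[OF u(2,3) w(2,3) u(4) 1 w(5)] u(1) w(1) by simp
      next
        case 2
        have "\<Phi> w = u \<or> (\<exists>i\<in>I. \<exists>g\<in>S i. \<exists>j\<in>{1..n}. {w, u} = {g 0, g j})"
          using mixed_edge[OF w(2,3) u(2,3) w(4) 2 u(5)] u(1) w(1) by simp
        then show ?thesis using \<Phi>[OF wV] by (auto simp: insert_commute)
      next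
        case 3
        have "x \<noteq> y" using 3 uw u(1) w(1) by auto
        have "(y - x) mod M \<noteq> 0"
        proof
          assume "(y - x) mod M = 0"
          then have "M dvd y - x" by auto
          then show False using dvd_imp_le_int[of "y - x" M] u w \<open>x \<noteq> y\<close> by auto
        qed
        then have "0 < (y - x) mod M" "(y - x) mod M < M"
          using pos_mod_sign[OF M, of "y - x"] pos_mod_bound[OF M, of "y - x"] by linarith+
        then obtain d' where d': "M dvd d' - (y - x) mod M" "diff a a d'"
          using pure[of a "(y - x) mod M"] u by (auto simp: M_def)
        have "M dvd d' - (y - x)" using d'(1) by (metis mod_eq_dvd_iff mod_mod_trivial)
        then show ?thesis using diff_edge[OF u(2,3) w(2,3) _ d'(2)] 3 u(1) w(1) by simp
      qed
    qed
    show "2 * card I * m * n + card V \<le> card V * (card V - 1)"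
    proof -
      have "2 * card I * n + 2 * (n + 1) \<le> (n + 1) * card V"
        using count cardI V(2) by simp
      \<comment> \<open>The hypothesis \<open>count\<close> is the edge count with the common factor
        \<open>m\<close> removed.\<close>
      then have "m * (2 * card I * n + 2 * (n + 1)) \<le> m * ((n + 1) * card V)" by (rule mult_le_mono2)
      then have "2 * card I * m * n + 2 * card V \<le> card V * card V"
        using V(2) by (simp add: algebra_simps)
      then show ?thesis by (simp add: diff_mult_distrib2)
    qed
  qed
  then show ?thesis using V cardI by simp
qed

lemma base_diff_mono: "base_diff P n a b d \<Longrightarrow> P \<subseteq> P' \<Longrightarrow> base_diff P' n a b d"
  unfolding base_diff_def by blast

lemma base_diff_uminus: "base_diff P n a b d \<Longrightarrow> base_diff P n b a (- d)"
  unfolding base_diff_def by fastforce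

section \<open>The base class\<close>

text \<open>
  The differences $d = g+1, \dots, g+Kn$ are split by the parity of $(d-g-1)$ modulo $K$ into two nests of column stars:
  one has its centres to the left and its leaves to the right, the other conversely, and their
  leaves interleave to fill the columns $g+1, \dots, g+Kn$ without gaps. Gaps of $g$ and $g+1$
  columns remain between the leaves and the left and right centres.
\<close>

definition pure_blocks :: "nat \<Rightarrow> int \<Rightarrow> int \<Rightarrow> (nat \<Rightarrow> int \<times> int) set" where
  "pure_blocks n K g =
     (\<lambda>(t, r) j. (if j = 0 then - t else g + 1 + t + K * (int j - 1), r)) `
       ({0..<(K + 1) div 2} \<times> {0..int n}) \<union>
     (\<lambda>(t, r) j. (if j = 0 then K * int n + 2 * g + 2 + t else K * int n + g - t - K * (int j - 1), r)) `
       ({0..<K div 2} \<times> {0..int n})"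

text \<open>The star takes the row 0 point of column \<open>y\<close> and all other points of column
  \<open>z\<close>. If \<open>z\<close> arises from \<open>y\<close> by a permutation of some
  columns, these stars exactly fill those columns. Each one uses the same difference
  \<open>z - y\<close> from row 0 to every other row.\<close>

definition charged_star :: "int \<Rightarrow> int \<Rightarrow> nat \<Rightarrow> int \<times> int" where
  "charged_star y z j = (if j = 0 then (y, 0) else (z, int j))"

text \<open>Reflecting an interval of columns makes all differences between a leaf and its centre distinct.\<close>

definition reflected_stars :: "int \<Rightarrow> int \<Rightarrow> (nat \<Rightarrow> int \<times> int) set" where
  "reflected_stars L p = (\<lambda>x. charged_star x (2 * L + p - 1 - x)) ` {L..<L + p}"

section \<open>Column stars that stay inside a row\<close>

lemma pure_blocks_card:
  assumes "K \<ge> 0"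
  shows "finite (pure_blocks n K g)" "int (card (pure_blocks n K g)) \<le> K * (int n + 1)"
proof -
  show "finite (pure_blocks n K g)" by (simp add: pure_blocks_def)
  let ?R = "{0..int n}"
  have "card (pure_blocks n K g) \<le> card ({0..<(K + 1) div 2} \<times> ?R) + card ({0..<K div 2} \<times> ?R)"
    unfolding pure_blocks_def
    by (rule order_trans[OF card_Un_le]) (intro add_mono card_image_le; simp)
  also have "\<dots> = (nat ((K + 1) div 2) + nat (K div 2)) * (n + 1)"
    by (simp add: card_cartesian_product nat_add_distrib algebra_simps)
  finally have "int (card (pure_blocks n K g)) \<le> ((K + 1) div 2 + K div 2) * (int n + 1)"
    using assms by (simp add: zle_int[symmetric] algebra_simps)
  also have "(K + 1) div 2 + K div 2 = K" by presburger
  finally show "int (card (pure_blocks n K g)) \<le> K * (int n + 1)" .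
qed

lemma pure_blocks_rows:
  "s \<in> pure_blocks n K g \<Longrightarrow> snd (s j) \<in> {0..int n}"
  by (auto simp: pure_blocks_def)

text \<open>Division by \<open>K\<close>, with the quotient shifted by one because leaves are
  numbered from 1.\<close>

lemma block_index:
  fixes K :: int
  assumes "0 \<le> x" "x < K * int n"
  obtains j e where "j \<in> {1..n}" "x = K * (int j - 1) + e" "0 \<le> e" "e < K"
proof -
  have K: "K > 0" using assms by (metis int_nat_eq le_less_trans mult_nonpos_nonneg not_le of_nat_0_le_iff)
  have eq: "K * (x div K) + x mod K = x" by simp
  have "x div K \<ge> 0" using K assms by (simp add: pos_imp_zdiv_nonneg_iff)
  moreover have "x div K < int n"
  proof (rule ccontr)
    assume "\<not> x div K < int n"
    then have "K * int n \<le> K * (x div K)" using K by (intro mult_left_mono) auto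
    then show False using eq assms pos_mod_sign[OF K, of x] by linarith
  qed
  ultimately show ?thesis using that[of "nat (x div K) + 1" "x mod K"] K eq by simp
qed

text \<open>Leaf \<open>j\<close> of star \<open>t\<close> has distance
  \<open>g + 1 + 2 * t + K * (j - 1)\<close> from its centre in the first nest and one more in the
  second. So the parity of the remainder \<open>e\<close> selects the nest.\<close>

lemma pure_blocks_diff:
  assumes a: "a \<in> {0..int n}" and d: "g + 1 \<le> d" "d \<le> g + K * int n"
  shows "base_diff (pure_blocks n K g) n a a d"
proof -
  have "0 \<le> d - g - 1" "d - g - 1 < K * int n" using d by simp_all
  then obtain j e where j: "j \<in> {1..n}" "d - g - 1 = K * (int j - 1) + e" "0 \<le> e" "e < K"
    by (rule block_index)
  have j0: "j \<noteq> 0" using j by auto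
  show ?thesis
  proof (cases "even e")
    case True
    then obtain t where t: "e = 2 * t" by auto
    let ?s = "\<lambda>j :: nat. (if j = 0 then - t else g + 1 + t + K * (int j - 1), a)"
    have "t \<in> {0..<(K + 1) div 2}" using t j by auto
    then have "?s \<in> pure_blocks n K g" using a unfolding pure_blocks_def by (intro UnI1 rev_image_eqI) auto
    then show ?thesis unfolding base_diff_def using j j0 t
      by (intro bexI[of _ ?s] bexI[of _ j] disjI1) auto
  next
    case False
    then obtain t where t: "e = 2 * t + 1" by (auto elim: oddE)
    let ?s = "\<lambda>j :: nat. (if j = 0 then K * int n + 2 * g + 2 + t else K * int n + g - t - K * (int j - 1), a)"
    have "t \<in> {0..<K div 2}" using t j by auto
    then have "?s \<in> pure_blocks n K g" using a unfolding pure_blocks_def by (intro UnI2 rev_image_eqI) auto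
    then show ?thesis unfolding base_diff_def using j j0 t
      by (intro bexI[of _ ?s] bexI[of _ j] disjI2) auto
  qed
qed

lemma pure_blocks_cover:
  assumes r: "r \<in> {0..int n}"
    and x: "(- ((K + 1) div 2) < x \<and> x \<le> 0) \<or> (g + 1 \<le> x \<and> x \<le> g + K * int n) \<or>
      (K * int n + 2 * g + 2 \<le> x \<and> x < K * int n + 2 * g + 2 + K div 2)"
  shows "\<exists>s\<in>pure_blocks n K g. \<exists>j\<le>n. s j = (x, r)"
proof -
  let ?s1 = "\<lambda>t j. (if j = 0 then - t else g + 1 + t + K * (int j - 1), r)"
  let ?s2 = "\<lambda>t j. (if j = 0 then K * int n + 2 * g + 2 + t else K * int n + g - t - K * (int j - 1), r)"
  have s1: "?s1 t \<in> pure_blocks n K g" if "t \<in> {0..<(K + 1) div 2}" for t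
    using that r unfolding pure_blocks_def by (intro UnI1 rev_image_eqI) auto
  have s2: "?s2 t \<in> pure_blocks n K g" if "t \<in> {0..<K div 2}" for t
    using that r unfolding pure_blocks_def by (intro UnI2 rev_image_eqI) auto
  from x consider "- ((K + 1) div 2) < x \<and> x \<le> 0" | "g + 1 \<le> x \<and> x \<le> g + K * int n"
    | "K * int n + 2 * g + 2 \<le> x \<and> x < K * int n + 2 * g + 2 + K div 2" by blast
  then show ?thesis
  proof cases
    case 1
    then show ?thesis using s1[of "- x"] by (intro bexI[of _ "?s1 (- x)"] exI[of _ 0]) auto
  next
    case 2
    have "0 \<le> x - g - 1" "x - g - 1 < K * int n" using 2 by simp_all
    then obtain j e where j: "j \<in> {1..n}" "x - g - 1 = K * (int j - 1) + e" "0 \<le> e" "e < K"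
      by (rule block_index)
    show ?thesis
    proof (cases "e < (K + 1) div 2")
      case True
      then show ?thesis using s1[of e] j by (intro bexI[of _ "?s1 e"] exI[of _ j]) auto
    next
      case False
      \<comment> \<open>Leaves of the second nest are numbered from right to left, which reverses
        both the leaf number and the remainder.\<close>
      define i where "i = n + 1 - j"
      have i: "i \<noteq> 0" "i \<le> n" "int i = int n + 1 - int j" using j by (auto simp: i_def)
      have "K * int n + g - (K - 1 - e) - K * (int i - 1) = x"
      proof -
        have "K * (int i - 1) = K * int n - K * int j" unfolding i(3) by (simp add: algebra_simps)
        then show ?thesis using j(2) by (simp add: algebra_simps)
      qed
      moreover have "K - 1 - e \<in> {0..<K div 2}" using False j by auto
      ultimately show ?thesis using s2[of "K - 1 - e"] i
        by (intro bexI[of _ "?s2 (K - 1 - e)"] exI[of _ i]) auto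
    qed
  next
    case 3
    define t where "t = x - (K * int n + 2 * g + 2)"
    have "t \<in> {0..<K div 2}" using 3 by (auto simp: t_def)
    then show ?thesis using s2[of t] by (intro bexI[of _ "?s2 t"] exI[of _ 0]) (auto simp: t_def)
  qed
qed

section \<open>Stars centred in row 0\<close>

lemma charged_star_rows: "j \<le> n \<Longrightarrow> snd (charged_star y z j) \<in> {0..int n}"
  by (simp add: charged_star_def)

lemma charged_star_diff:
  assumes "charged_star y z \<in> P" "1 \<le> b" "b \<le> int n"
  shows "base_diff P n 0 b (z - y)"
  unfolding base_diff_def using assms
  by (intro bexI[of _ "charged_star y z"] bexI[of _ "nat b"] disjI1) (auto simp: charged_star_def)

text \<open>One star supplies the centre in row 0, the other the leaves in the remaining rows; they
  may be the same star.\<close>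

lemma charged_star_cover:
  assumes "charged_star x z \<in> P" "charged_star y x \<in> P" "r \<in> {0..int n}"
  shows "\<exists>s\<in>P. \<exists>j\<le>n. s j = (x, r)"
proof (cases "r = 0")
  case True
  then show ?thesis using assms(1) by (intro bexI[of _ "charged_star x z"] exI[of _ 0]) (auto simp: charged_star_def)
next
  case False
  then show ?thesis using assms
    by (intro bexI[of _ "charged_star y x"] exI[of _ "nat r"]) (auto simp: charged_star_def)
qed

lemma reflected_stars_card:
  "finite (reflected_stars L p)" "card (reflected_stars L p) \<le> nat p"
  using card_image_le[of "{L..<L + p}" "\<lambda>x. charged_star x (2 * L + p - 1 - x)"]
  by (simp_all add: reflected_stars_def)

lemma reflected_stars_mem:
  assumes "L \<le> x" "x < L + p"
  shows "charged_star x (2 * L + p - 1 - x) \<in> reflected_stars L p"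
  unfolding reflected_stars_def using assms by (intro imageI) auto

text \<open>Reflection is an involution of the interval, so each column is a centre column once and
  a leaf column once.\<close>

lemma reflected_stars_cover:
  assumes "L \<le> x" "x < L + p" "r \<in> {0..int n}"
  shows "\<exists>s\<in>reflected_stars L p. \<exists>j\<le>n. s j = (x, r)"
  using reflected_stars_mem[OF assms(1,2)] reflected_stars_mem[of L "2 * L + p - 1 - x" p] assms
  by (intro charged_star_cover) auto

lemma reflected_stars_diff:
  assumes "0 \<le> i" "i < p" "1 \<le> b" "b \<le> int n"
  shows "base_diff (reflected_stars L p) n 0 b (p - 1 - 2 * i)"
proof -
  have "charged_star (L + i) (2 * L + p - 1 - (L + i)) \<in> reflected_stars L p"
    using assms by (intro reflected_stars_mem) auto
  from charged_star_diff[OF this assms(3,4)] show ?thesis by simp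
qed

lemma card_reflected_diffs:
  "card ((\<lambda>i. p - 1 - 2 * i) ` {0..<p :: int}) = nat p"
  by (subst card_image) (auto simp: inj_on_def)

section \<open>Representatives of columns and sums over rows\<close>

lemma bex_subset: "\<exists>x\<in>A. Q x \<Longrightarrow> A \<subseteq> B \<Longrightarrow> \<exists>x\<in>B. Q x"
  by blast

text \<open>Columns modulo \<open>M\<close> are represented in a window that can start at the
  leftmost centre of \<open>pure_blocks\<close>.\<close>

lemma mod_window:
  fixes x M e :: int
  assumes "M > 0"
  obtains x' where "- e < x'" "x' \<le> M - e" "M dvd x' - x"
proof (rule that[of "(x + e - 1) mod M - e + 1"])
  show "- e < (x + e - 1) mod M - e + 1" using pos_mod_sign[OF assms, of "x + e - 1"] by linarith
  show "(x + e - 1) mod M - e + 1 \<le> M - e" using pos_mod_bound[OF assms, of "x + e - 1"] by linarith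
  have "((x + e - 1) mod M - (x + e - 1)) mod M = 0" by (simp add: mod_diff_left_eq)
  then have "M dvd (x + e - 1) mod M - (x + e - 1)" by auto
  then show "M dvd (x + e - 1) mod M - e + 1 - x" by (simp add: algebra_simps)
qed

lemma sum_rows:
  "(\<Sum>a\<in>{0..int n}. if a = 0 then (u :: nat) else w) = u + n * w"
proof -
  have "{0..int n} = insert 0 {1..int n}" by auto
  then show ?thesis by simp
qed

section \<open>Existence\<close>

text \<open>From left to right the window holds: \<open>E1\<close> left centres, the leaves
  \<open>1\<close> to \<open>k * n\<close>, the gap column \<open>x0\<close>, \<open>E2\<close>
  right centres, the reflected interval of length \<open>p\<close>, and a last column
  \<open>e\<close>. Two charged stars exchange \<open>x0\<close> and \<open>e\<close>.\<close>

lemma URD_even_columns: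
  assumes n: "n = 2 * c + 1" and K: "K \<ge> 1"
  shows "\<exists>s\<ge>1. URD is_K2_copy (is_star_copy n) ((2 * K * n + 2) * (n + 1)) 1 s"
proof -
  define m where "m = 2 * K * n + 2"
  define k where "k = int K"
  define E1 where "E1 = (k + 1) div 2"
  define E2 where "E2 = k div 2"
  define h where "h = int K * int c"
  have k: "k \<ge> 1" using K by (simp add: k_def)
  have E: "E1 + E2 = k" "E2 \<ge> 0" "E1 \<ge> 1" "E2 < k" using k by (auto simp: E1_def E2_def)
  have h: "h \<ge> 0" by (simp add: h_def)
  have kn: "k * int n = 2 * h + k" by (simp add: k_def h_def n algebra_simps)
  have im: "int m = 4 * h + 2 * k + 2" using kn by (simp add: m_def k_def)
  define L where "L = k * int n + 2 + E2"
  define p where "p = 2 * h"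
  define e where "e = L + p"
  \<comment> \<open>Besides being the gap column, this number is \<open>m / 2\<close>, the
    difference of the 1-factor.\<close>
  define x0 where "x0 = k * int n + 1"
  have e: "e = int m - E1" using E kn im by (simp add: e_def L_def p_def)
  define P where "P = pure_blocks n k 0 \<union> reflected_stars L p \<union> {charged_star x0 e, charged_star e x0}"
  \<comment> \<open>Pairs of rows avoiding row 0 have no used difference, so \<open>q\<close> is
    \<open>m / 2\<close> there. Row 0 has \<open>p + 2\<close> used differences to each other row,
    which leaves \<open>K - 1\<close> classes for it; this is why \<open>K = 0\<close> needs a
    separate construction.\<close>
  define q :: "int \<Rightarrow> nat" where "q a = (if a = 0 then K - 1 else K * n + 1)" for a
  have sub: "pure_blocks n k 0 \<subseteq> P" "reflected_stars L p \<subseteq> P" by (auto simp: P_def)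
  have "URD is_K2_copy (is_star_copy n) (m * (n + 1)) 1 (m + (\<Sum>a\<in>{0..int n}. q a))"
  proof (rule developed_URD[where P = P and \<rho> = "\<lambda>a. a" and \<phi> = "\<lambda>_. x0"])
    show "m > 0" "n \<ge> 1" by (simp_all add: m_def n)
    show "finite P" using pure_blocks_card(1) reflected_stars_card(1) k by (simp add: P_def)
    show "card P \<le> m"
    proof -
      have "card P \<le> card (pure_blocks n k 0) + card (reflected_stars L p) + card {charged_star x0 e, charged_star e x0}"
        unfolding P_def by (meson add_right_mono card_Un_le order_trans)
      moreover have "card {charged_star x0 e, charged_star e x0} \<le> 2" by (rule card_insert_le_m1) auto
      ultimately have "int (card P) \<le> k * (int n + 1) + p + 2"
        using pure_blocks_card(2)[of k n 0] reflected_stars_card(2)[of L p] k h by (simp add: p_def)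
      then show ?thesis using kn im by (simp add: p_def algebra_simps)
    qed
    show "snd (g j) \<in> {0..int n}" if "g \<in> P" "j \<le> n" for g j
      using that pure_blocks_rows charged_star_rows unfolding P_def reflected_stars_def by blast
    show "\<exists>g\<in>P. \<exists>j\<le>n. snd (g j) = r \<and> int m dvd fst (g j) - x" if r: "r \<in> {0..int n}" for x r
    proof -
      obtain x' where x': "- E1 < x'" "x' \<le> int m - E1" "int m dvd x' - x"
        using mod_window[of "int m" E1 x] im h k by auto
      have "\<exists>g\<in>P. \<exists>j\<le>n. g j = (x', r)"
      proof -
        \<comment> \<open>The zeros keep the shape of \<open>pure_blocks_cover\<close> at
          \<open>g = 0\<close>.\<close>
        consider "x' = x0" | "x' = e" | "L \<le> x'" "x' < L + p" | "- E1 < x' \<and> x' \<le> 0 \<or> 0 + 1 \<le> x' \<and> x' \<le> 0 + k * int n \<or>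
          k * int n + 2 * 0 + 2 \<le> x' \<and> x' < k * int n + 2 * 0 + 2 + E2"
          using x' e unfolding x0_def L_def e_def by linarith
        then show ?thesis
        proof cases
          case 1
          then show ?thesis using charged_star_cover[of x0 e P e r n] r by (simp add: P_def)
        next
          case 2
          then show ?thesis using charged_star_cover[of e x0 P x0 r n] r by (simp add: P_def)
        next
          case 3
          then show ?thesis by (rule bex_subset[OF reflected_stars_cover[OF _ _ r] sub(2)])
        next
          case 4
          then show ?thesis unfolding E1_def E2_def by (rule bex_subset[OF pure_blocks_cover[OF r] sub(1)])
        qed
      qed
      then show ?thesis using x'(3) by (metis fst_conv snd_conv)
    qed
    have "\<not> int m dvd x0" using zdvd_not_zless[of x0 "int m"] kn im h k by (simp add: x0_def)
    then show "r \<in> {0..int n} \<and> r = r \<and> int m dvd x0 + x0 \<and> (r = r \<longrightarrow> \<not> int m dvd x0)"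
      if "r \<in> {0..int n}" for r
    proof -
      have "x0 + x0 = int m" using kn im by (simp add: x0_def)
      then show ?thesis using that \<open>\<not> int m dvd x0\<close> by simp
    qed
    show "\<exists>d'. int m dvd d' - d \<and> (base_diff P n a a d' \<or> a = a \<and> d' = x0)"
      if a: "a \<in> {0..int n}" and d: "0 < d" "d < int m" for a d
    proof -
      consider "d \<le> k * int n" | "d = x0" | "int m - d \<le> k * int n"
        using d im kn by (simp add: x0_def) linarith
      then show ?thesis
      proof cases
        case 1
        then show ?thesis using base_diff_mono[OF pure_blocks_diff[OF a, of 0 d k] sub(1)] d
          by (intro exI[of _ d]) auto
      next
        case 3
        have "base_diff P n a a (int m - d)"
          using base_diff_mono[OF pure_blocks_diff[OF a, of 0 "int m - d" k] sub(1)] d 3 by auto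
        then have "base_diff P n a a (- (int m - d))" by (rule base_diff_uminus)
        then show ?thesis by (intro exI[of _ "- (int m - d)"]) auto
      qed (intro exI[of _ x0], auto)
    qed
    show "\<exists>T. finite T \<and> (\<forall>d\<in>T. 2 * \<bar>d\<bar> < int m \<and> (base_diff P n a b d \<or> a = b \<and> d = x0)) \<and>
      m \<le> card T + q a + q b" if ab: "0 \<le> a" "a < b" "b \<le> int n" for a b
    proof (cases "a = 0")
      case True
      define R where "R = (\<lambda>i. p - 1 - 2 * i) ` {0..<p}"
      \<comment> \<open>The two exchange differences have absolute value \<open>p + 1 + E2\<close>,
        beyond the reflected ones, which stay below \<open>p\<close>, yet still below
        \<open>m / 2\<close>.\<close>
      define T where "T = R \<union> {e - x0, x0 - e}"
      have ex: "e - x0 = p + 1 + E2" by (simp add: e_def L_def x0_def)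
      have "card T = card R + card {e - x0, x0 - e}"
        unfolding T_def using ex E h by (intro card_Un_disjoint) (auto simp: R_def p_def)
      moreover have "card {e - x0, x0 - e} = 2" using ex E h by (simp add: p_def)
      ultimately have "card T = nat p + 2" unfolding R_def by (simp add: card_reflected_diffs)
      then have "int m \<le> int (card T + q a + q b)"
        using True ab K h im kn by (simp add: q_def p_def k_def of_nat_diff)
      moreover have "base_diff P n a b d" if "d \<in> T" for d
        using that True ab base_diff_mono[OF reflected_stars_diff sub(2)]
          charged_star_diff[of x0 e P b n] charged_star_diff[of e x0 P b n]
        by (auto simp: T_def R_def P_def)
      moreover have "2 * \<bar>d\<bar> < int m" if "d \<in> T" for d
      proof -
        have "\<bar>d\<bar> \<le> p + 1 + E2" using that ex E h by (auto simp: T_def R_def p_def abs_le_iff)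
        then show ?thesis using im E by (simp add: p_def)
      qed
      ultimately show ?thesis by (intro exI[of _ T]) (auto simp: T_def R_def)
    next
      case False
      then show ?thesis using ab by (intro exI[of _ "{}"]) (simp add: q_def m_def)
    qed
    show "2 * (m + (\<Sum>a\<in>{0..int n}. q a)) * n + 2 * (n + 1) \<le> (n + 1) * (m * (n + 1))"
    proof -
      obtain K' where "K = Suc K'" using K by (cases K) auto
      then show ?thesis unfolding q_def sum_rows m_def by (simp add: algebra_simps)
    qed
  qed
  then show ?thesis unfolding m_def by (intro exI[of _ "m + (\<Sum>a\<in>{0..int n}. q a)"]) (simp add: m_def)
qed

text \<open>Here \<open>m = 2 * (k * n + g) + 1\<close>. \<open>pure_blocks\<close> supplies the
  differences above \<open>g\<close> and \<open>special\<close> those from \<open>1\<close> to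
  \<open>g\<close>. In the window, the left gap \<open>1\<close> to \<open>g\<close> holds the
  row-changing leaves of \<open>special\<close> and then the column of
  \<open>charged_star g g\<close>; the right gap of \<open>g + 1\<close> columns holds the rest of
  \<open>special\<close>.\<close>

lemma URD_odd_columns:
  assumes n: "n = 2 * c + 1" and c: "c \<ge> 1"
  shows "\<exists>s\<ge>1. URD is_K2_copy (is_star_copy n) ((2 * K * n + n + 2) * (n + 1)) 1 s"
proof -
  define m where "m = 2 * K * n + n + 2"
  define k where "k = int K"
  define E1 where "E1 = (k + 1) div 2"
  define E2 where "E2 = k div 2"
  define h where "h = int K * int c"
  define g where "g = int c + 1"
  define N where "N = int n + 1"
  have k: "k \<ge> 0" by (simp add: k_def)
  have E: "E1 + E2 = k" "E2 \<ge> 0" "E1 \<ge> 0" using k by (auto simp: E1_def E2_def)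
  have h: "h \<ge> 0" by (simp add: h_def)
  have g: "g \<ge> 2" "N = 2 * g" "int n = 2 * g - 1" using c by (auto simp: g_def N_def n)
  have kn: "k * int n = 2 * h + k" by (simp add: k_def h_def n algebra_simps)
  have im: "int m = 4 * h + 2 * k + 2 * g + 1" using kn by (simp add: m_def k_def g_def n algebra_simps)
  define L where "L = k * int n + 2 * g + 2 + E2"
  define p where "p = 2 * h"
  define w where "w = g + k * int n + 1"
  define f where "f = k * int n + g"
  \<comment> \<open>The centre is \<open>(w, r)\<close>. The last \<open>g - 1\<close> leaves move
    to rows \<open>r + 1\<close> up to \<open>r + g - 1\<close>, so the stars over all
    \<open>r\<close> still fill each of these columns.\<close>
  define special where "special r = (\<lambda>j. if int j \<le> g then (w + int j, r) else (int j - g, (r + (int j - g)) mod N))" for r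
  define P where "P = pure_blocks n k g \<union> reflected_stars L p \<union> special ` {0..int n} \<union> {charged_star g g}"
  define \<rho> where "\<rho> r = (if r < g then r + g else r - g)" for r
  \<comment> \<open>Opposite signs make the 1-factor an involution; \<open>f\<close> equals
    \<open>(m - 1) / 2\<close>, which lies outside the range of the reflected differences.\<close>
  define \<phi> where "\<phi> r = (if r < g then f else - f)" for r
  define q :: "int \<Rightarrow> nat" where "q a = (if a = 0 then K + c else K * n + c + 1)" for a
  have sub: "pure_blocks n k g \<subseteq> P" "reflected_stars L p \<subseteq> P" "charged_star g g \<in> P"
    and special: "\<And>r. r \<in> {0..int n} \<Longrightarrow> special r \<in> P" by (auto simp: P_def)
  have "URD is_K2_copy (is_star_copy n) (m * (n + 1)) 1 (m + (\<Sum>a\<in>{0..int n}. q a))"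
  proof (rule developed_URD[where P = P and \<rho> = \<rho> and \<phi> = \<phi>])
    show "m > 0" "n \<ge> 1" by (simp_all add: m_def n)
    show "finite P" using pure_blocks_card(1) reflected_stars_card(1) k by (simp add: P_def)
    show "card P \<le> m"
    proof -
      have "card P \<le> card (pure_blocks n k g \<union> reflected_stars L p \<union> special ` {0..int n}) + card {charged_star g g}"
        unfolding P_def by (rule card_Un_le)
      also have "card (pure_blocks n k g \<union> reflected_stars L p \<union> special ` {0..int n}) \<le>
          card (pure_blocks n k g \<union> reflected_stars L p) + card (special ` {0..int n})" by (rule card_Un_le)
      also have "card (pure_blocks n k g \<union> reflected_stars L p) \<le> card (pure_blocks n k g) + card (reflected_stars L p)"
        by (rule card_Un_le)
      also have "card (special ` {0..int n}) \<le> card {0..int n}" by (intro card_image_le) simp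
      finally have "int (card P) \<le> k * (int n + 1) + p + (int n + 1) + 1"
        using pure_blocks_card(2)[OF k, of n g] reflected_stars_card(2)[of L p] h by (simp add: p_def)
      then show ?thesis using kn im g by (simp add: p_def algebra_simps)
    qed
    show "snd (s j) \<in> {0..int n}" if "s \<in> P" "j \<le> n" for s j
    proof -
      have "snd (special r j) \<in> {0..int n}" if "r \<in> {0..int n}" for r
        using that pos_mod_sign[of N] pos_mod_bound[of N] by (simp add: special_def N_def)
      then show ?thesis using that pure_blocks_rows charged_star_rows
        unfolding P_def reflected_stars_def by blast
    qed
    show "\<exists>s\<in>P. \<exists>j\<le>n. snd (s j) = r \<and> int m dvd fst (s j) - x" if r: "r \<in> {0..int n}" for x r
    proof -
      obtain x' where x': "- E1 < x'" "x' \<le> int m - E1" "int m dvd x' - x"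
        using mod_window[of "int m" E1 x] im h k g by auto
      have "\<exists>s\<in>P. \<exists>j\<le>n. s j = (x', r)"
      proof -
        have "int m - E1 < L + p" using E kn im by (simp add: L_def p_def)
        then consider "x' = g" | "1 \<le> x'" "x' < g" | "w \<le> x'" "x' \<le> w + g" | "L \<le> x'" "x' < L + p"
          | "- E1 < x' \<and> x' \<le> 0 \<or> g + 1 \<le> x' \<and> x' \<le> g + k * int n \<or>
             k * int n + 2 * g + 2 \<le> x' \<and> x' < k * int n + 2 * g + 2 + E2"
          using x' unfolding w_def L_def by linarith
        then show ?thesis
        proof cases
          case 1
          then show ?thesis using charged_star_cover[OF sub(3,3) r] by simp
        next
          case 2
          define r' where "r' = (r - x') mod N"
          have r': "r' \<in> {0..int n}"
            using pos_mod_sign[of N "r - x'"] pos_mod_bound[of N "r - x'"] g by (simp add: r'_def N_def)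
          have "(r' + x') mod N = r" using r by (simp add: r'_def N_def mod_add_left_eq)
          then have "special r' (nat (x' + g)) = (x', r)" using 2 g by (simp add: special_def)
          moreover have "nat (x' + g) \<le> n" using 2 g by linarith
          ultimately show ?thesis using special[OF r'] by (intro bexI[of _ "special r'"] exI[of _ "nat (x' + g)"]) auto
        next
          case 3
          then have "special r (nat (x' - w)) = (x', r)" by (simp add: special_def)
          moreover have "nat (x' - w) \<le> n" using 3 g by linarith
          ultimately show ?thesis using special[OF r] by (intro bexI[of _ "special r"] exI[of _ "nat (x' - w)"]) auto
        next
          case 4
          then show ?thesis by (rule bex_subset[OF reflected_stars_cover[OF _ _ r] sub(2)])
        next
          case 5
          then show ?thesis unfolding E1_def E2_def by (rule bex_subset[OF pure_blocks_cover[OF r] sub(1)])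
        qed
      qed
      then show ?thesis using x'(3) by (metis fst_conv snd_conv)
    qed
    show "\<rho> r \<in> {0..int n} \<and> \<rho> (\<rho> r) = r \<and> int m dvd \<phi> r + \<phi> (\<rho> r) \<and> (\<rho> r = r \<longrightarrow> \<not> int m dvd \<phi> r)"
      if "r \<in> {0..int n}" for r
      using that g by (auto simp: \<rho>_def \<phi>_def)
    have pure: "base_diff P n a a d" if a: "a \<in> {0..int n}" and d: "0 < d" "d \<le> k * int n + g" for a d
    proof (cases "d \<le> g")
      case True
      then have "special a (nat d) = (w + d, a)" "special a 0 = (w, a)" using d g by (simp_all add: special_def)
      moreover have "nat d \<in> {1..n}" using True d g by auto
      ultimately show ?thesis unfolding base_diff_def using special[OF a]
        by (intro bexI[of _ "special a"] bexI[of _ "nat d"] disjI1) auto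
    next
      case False
      then show ?thesis using base_diff_mono[OF pure_blocks_diff[OF a, of g d k] sub(1)] d by auto
    qed
    show "\<exists>d'. int m dvd d' - d \<and> (base_diff P n a a d' \<or> \<rho> a = a \<and> d' = \<phi> a)"
      if a: "a \<in> {0..int n}" and d: "0 < d" "d < int m" for a d
    proof (cases "d \<le> k * int n + g")
      case True
      then show ?thesis using pure[OF a d(1)] by (intro exI[of _ d]) auto
    next
      case False
      then have "base_diff P n a a (int m - d)" using d im kn by (intro pure[OF a]) auto
      then have "base_diff P n a a (- (int m - d))" by (rule base_diff_uminus)
      then show ?thesis by (intro exI[of _ "- (int m - d)"]) auto
    qed
    show "\<exists>T. finite T \<and> (\<forall>d\<in>T. 2 * \<bar>d\<bar> < int m \<and> (base_diff P n a b d \<or> \<rho> a = b \<and> d = \<phi> a)) \<and>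
      m \<le> card T + q a + q b" if ab: "0 \<le> a" "a < b" "b \<le> int n" for a b
    proof -
      \<comment> \<open>The balancing step: every pair of rows gets one further difference, from the
        1-factor if the rows are \<open>g\<close> apart and from a row-changing leaf otherwise. The
        bound by \<open>p\<close> keeps it off the reflected differences.\<close>
      have "\<exists>t. p \<le> \<bar>t\<bar> \<and> 0 < \<bar>t\<bar> \<and> 2 * \<bar>t\<bar> < int m \<and> (base_diff P n a b t \<or> \<rho> a = b \<and> t = \<phi> a)"
      proof -
        have shifted: "base_diff P n r ((r + i) mod N) (i - w)"
          if r: "r \<in> {0..int n}" and i: "1 \<le> i" "i < g" for r i
        proof -
          have "special r (nat (g + i)) = (i, (r + i) mod N)" "special r 0 = (w, r)"
            using i g by (simp_all add: special_def)
          moreover have "nat (g + i) \<in> {1..n}" using i g by auto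
          ultimately show ?thesis unfolding base_diff_def using special[OF r]
            by (intro bexI[of _ "special r"] bexI[of _ "nat (g + i)"] disjI1) auto
        qed
        consider "b - a < g" | "b - a = g" | "b - a > g" by linarith
        then show ?thesis
        proof cases
          case 1
          have "(a + (b - a)) mod N = b" using ab by (simp add: N_def)
          then have "base_diff P n a b (b - a - w)" using shifted[of a "b - a"] ab 1 by simp
          then show ?thesis using 1 ab kn im h k g
            by (intro exI[of _ "b - a - w"]) (simp add: w_def p_def)
        next
          case 2
          then have "\<rho> a = b" "\<phi> a = f" using ab g by (simp_all add: \<rho>_def \<phi>_def)
          then show ?thesis using kn im h k g by (intro exI[of _ f]) (simp add: f_def p_def)
        next
          case 3
          \<comment> \<open>Rows more than \<open>g\<close> apart are close the other way round the
            cycle, so the star of row \<open>b\<close> reaches row \<open>a\<close>.\<close>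
          define i where "i = N - (b - a)"
          have i: "1 \<le> i" "i < g" using 3 g ab by (auto simp: i_def)
          have "b + i = a + N" by (simp add: i_def)
          then have "(b + i) mod N = a" using ab by (simp add: N_def)
          then have "base_diff P n b a (i - w)" using shifted[of b i] ab i by simp
          then have "base_diff P n a b (- (i - w))" by (rule base_diff_uminus)
          then show ?thesis using i kn im h k g
            by (intro exI[of _ "- (i - w)"]) (simp add: w_def p_def)
        qed
      qed
      then obtain t where t: "p \<le> \<bar>t\<bar>" "0 < \<bar>t\<bar>" "2 * \<bar>t\<bar> < int m"
        "base_diff P n a b t \<or> \<rho> a = b \<and> t = \<phi> a" by blast
      show ?thesis
      proof (cases "a = 0")
        case True
        define R where "R = (\<lambda>i. p - 1 - 2 * i) ` {0..<p}"
        define T where "T = R \<union> {0, t}"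
        have "card T = card R + card {0, t}"
          unfolding T_def
        proof (rule card_Un_disjoint)
          \<comment> \<open>The reflected differences are odd, so they miss the difference 0 of
            \<open>charged_star g g\<close>.\<close>
          have "p - 1 - 2 * i \<noteq> 0" for i unfolding p_def by presburger
          moreover have "\<bar>p - 1 - 2 * i\<bar> < p" if "i \<in> {0..<p}" for i using that by auto
          ultimately show "R \<inter> {0, t} = {}" using t(1) unfolding R_def by fastforce
        qed (auto simp: R_def)
        moreover have "card {0, t} = 2" using t by simp
        ultimately have "card T = nat p + 2" unfolding R_def by (simp add: card_reflected_diffs)
        then have "int m \<le> int (card T + q a + q b)"
          using True ab h im kn by (simp add: q_def p_def k_def g_def)
        moreover have "base_diff P n a b d \<or> \<rho> a = b \<and> d = \<phi> a" if "d \<in> T" for d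
          using that True ab t(4) base_diff_mono[OF reflected_stars_diff sub(2)]
            charged_star_diff[OF sub(3), of b n]
          by (auto simp: T_def R_def)
        moreover have "2 * \<bar>d\<bar> < int m" if "d \<in> T" for d
        proof -
          have "\<bar>d\<bar> \<le> p \<or> d = t" using that h by (auto simp: T_def R_def p_def abs_le_iff)
          then show ?thesis using im t(3) g k by (auto simp: p_def)
        qed
        ultimately show ?thesis by (intro exI[of _ T]) (auto simp: T_def R_def)
      next
        case False
        \<comment> \<open>Away from row 0, \<open>q\<close> is \<open>(m - 1) / 2\<close>, and the
          single \<open>t\<close> makes up the missing one.\<close>
        then have "m \<le> card {t} + q a + q b" using ab by (simp add: q_def m_def n)
        then show ?thesis using t by (intro exI[of _ "{t}"]) simp
      qed
    qed
    show "2 * (m + (\<Sum>a\<in>{0..int n}. q a)) * n + 2 * (n + 1) \<le> (n + 1) * (m * (n + 1))"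
      unfolding q_def sum_rows m_def n by (simp add: algebra_simps)
  qed
  then show ?thesis unfolding m_def by (intro exI[of _ "m + (\<Sum>a\<in>{0..int n}. q a)"]) (simp add: m_def)
qed

text \<open>On the cycle of length \<open>N\<close>, the star at \<open>x\<close> has leaves
  \<open>x + 1\<close> to \<open>x + n\<close>. Class \<open>i\<close> consists of the stars at the
  antipodal points \<open>i\<close> and \<open>i + n + 1\<close>, and the 1-factor joins antipodal
  points.\<close>

lemma URD_two_columns:
  assumes n: "n \<ge> 1"
  shows "\<exists>s\<ge>1. URD is_K2_copy (is_star_copy n) (2 * (n + 1)) 1 s"
proof -
  define N where "N = 2 * (n + 1)"
  define S where "S i = (\<lambda>t j. (i + t + j) mod N) ` {0, n + 1}" for i :: nat
  define f where "f x = (x + (n + 1)) mod N" for x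
  have "URD is_K2_copy (is_star_copy n) (card {..<N}) 1 (card {..n})"
  proof (rule star_factors_imp_URD[where S = S and f = f and m = 2])
    show "card (S i) \<le> 2" for i
      unfolding S_def by (rule order_trans[OF card_image_le]) auto
    show "\<exists>g\<in>S i. \<exists>j\<le>n. g j = x" if i: "i \<in> {..n}" and x: "x \<in> {..<N}" for i x
    proof -
      define d where "d = (x + N - i) mod N"
      have d: "(i + d) mod N = x"
      proof -
        have "i + (x + N - i) = x + N" using i by (simp add: N_def)
        then show ?thesis unfolding d_def mod_add_right_eq using x by simp
      qed
      have "d < N" by (simp add: d_def N_def)
      show ?thesis
      proof (cases "d \<le> n")
        case True
        then show ?thesis using d by (auto simp: S_def intro!: exI[of _ d])
      next
        case False
        have "(i + (n + 1) + (d - (n + 1))) mod N = x" using d False by simp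
        moreover have "d - (n + 1) \<le> n" using \<open>d < N\<close> by (simp add: N_def)
        ultimately show ?thesis
          by (intro bexI[of _ "\<lambda>j. (i + (n + 1) + j) mod N"] exI[of _ "d - (n + 1)"]) (auto simp: S_def)
      qed
    qed
    show "f x \<in> {..<N} \<and> f x \<noteq> x \<and> f (f x) = x" if "x \<in> {..<N}" for x
    proof -
      have "f x = (if x < n + 1 then x + (n + 1) else x - (n + 1))"
        using that by (simp add: f_def N_def mod_if)
      moreover have "f (x + (n + 1)) = x" if "x < n + 1" using that by (simp add: f_def N_def mod_if)
      moreover have "f (x - (n + 1)) = x" if "\<not> x < n + 1" using that \<open>x \<in> {..<N}\<close> by (simp add: f_def)
      ultimately show ?thesis using that by (auto simp: N_def)
    qed
    have star: "\<exists>i\<in>{..n}. \<exists>g\<in>S i. g = (\<lambda>j. (x + j) mod N)" if "x < N" for x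
    proof (cases "x \<le> n")
      case True
      then show ?thesis by (intro bexI[of _ x]) (auto simp: S_def)
    next
      case False
      have "x - (n + 1) \<in> {..n}" using that by (simp add: N_def)
      moreover have "(\<lambda>j. (x + j) mod N) \<in> S (x - (n + 1))"
        using False by (auto simp: S_def intro!: image_eqI[of _ _ "n + 1"])
      ultimately show ?thesis by blast
    qed
    show "f x = y \<or> (\<exists>i\<in>{..n}. \<exists>g\<in>S i. \<exists>j\<in>{1..n}. {x, y} = {g 0, g j})"
      if x: "x \<in> {..<N}" and y: "y \<in> {..<N}" and xy: "x \<noteq> y" for x y
    proof -
      have edge: "\<exists>i\<in>{..n}. \<exists>g\<in>S i. \<exists>j\<in>{1..n}. {u, w} = {g 0, g j}"
        if uj: "u < N" "j \<in> {1..n}" "w = (u + j) mod N" for u w j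
      proof -
        obtain i where i: "i \<in> {..n}" "(\<lambda>j. (u + j) mod N) \<in> S i" using star[OF uj(1)] by blast
        then show ?thesis using uj
          by (intro bexI[OF _ i(1)] bexI[OF _ i(2)] bexI[OF _ uj(2)]) auto
      qed
      define d where "d = (y + N - x) mod N"
      have d: "(x + d) mod N = y" unfolding d_def mod_add_right_eq using x y by simp
      have dN: "d < N" by (simp add: d_def N_def)
      have d0: "d \<noteq> 0" using d xy x by (metis add.right_neutral lessThan_iff mod_less)
      \<comment> \<open>One end reaches the other within \<open>n\<close> steps forward, unless the
        two points are antipodal.\<close>
      have "d \<in> {1..n} \<or> d = n + 1 \<or> N - d \<in> {1..n}"
        using d0 dN unfolding N_def atLeastAtMost_iff by presburger
      then consider "d \<in> {1..n}" | "d = n + 1" | "N - d \<in> {1..n}" by blast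
      then show ?thesis
      proof cases
        case 1
        then show ?thesis using edge[of x d y] d x by auto
      next
        case 2
        then show ?thesis using d by (simp add: f_def)
      next
        case 3
        have "(y + (N - d)) mod N = (x + d + (N - d)) mod N" unfolding d[symmetric] by (rule mod_add_left_eq)
        also have "\<dots> = x" using x dN by simp
        finally show ?thesis using edge[of y "N - d" x] 3 y by (simp add: insert_commute)
      qed
    qed
    show "2 * card {..n} * 2 * n + card {..<N} \<le> card {..<N} * (card {..<N} - 1)"
      by (simp add: N_def algebra_simps)
  qed (use n in \<open>auto simp: S_def N_def\<close>)
  then show ?thesis by (intro exI[of _ "n + 1"]) (simp add: N_def)
qed

text \<open>The conditions \<open>v \<ge> 1\<close> and \<open>s \<ge> 1\<close> exclude degenerate
  designs: empty classes for \<open>v = 0\<close>, and the single edge with \<open>v = 2\<close> and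
  \<open>s = 0\<close>, neither of which satisfies the congruence.\<close>

theorem mainTheorem1:
  fixes n v :: nat
  assumes "odd n" and "n > 1" and "v \<ge> 1"
  shows "(\<exists>s\<ge>1. URD is_K2_copy (is_star_copy n) v 1 s)
         \<longleftrightarrow> v mod (n * (n + 1)) = (2 * (n + 1)) mod (n * (n + 1))"
proof
  assume "\<exists>s\<ge>1. URD is_K2_copy (is_star_copy n) v 1 s"
  then show "v mod (n * (n + 1)) = (2 * (n + 1)) mod (n * (n + 1))"
    using URD_imp_mod assms by auto
next
  assume v: "v mod (n * (n + 1)) = (2 * (n + 1)) mod (n * (n + 1))"
  obtain c where n: "n = 2 * c + 1" using \<open>odd n\<close> by (auto elim: oddE)
  then have c: "c \<ge> 1" using \<open>n > 1\<close> by simp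
  \<comment> \<open>As \<open>n \<ge> 3\<close>, the residue is \<open>2 * (n + 1)\<close> itself,
    so \<open>v\<close> has \<open>k * n + 2\<close> columns of size \<open>n + 1\<close> and the
    parity of \<open>k\<close> selects the construction.\<close>
  have "2 * (n + 1) < n * (n + 1)" using n c by (intro mult_strict_right_mono) auto
  then have "v mod (n * (n + 1)) = 2 * (n + 1)" using v by simp
  then obtain k where k: "v = k * (n * (n + 1)) + 2 * (n + 1)" by (metis div_mult_mod_eq)
  show "\<exists>s\<ge>1. URD is_K2_copy (is_star_copy n) v 1 s"
  proof (cases "even k")
    case True
    then obtain K where K: "k = 2 * K" by auto
    show ?thesis
    proof (cases "K = 0")
      case True
      then show ?thesis using URD_two_columns[of n] k K n by simp
    next
      case False
      have "v = (2 * K * n + 2) * (n + 1)" using k K by (simp add: algebra_simps)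
      then show ?thesis using URD_even_columns[OF n, of K] False by simp
    qed
  next
    case False
    then obtain K where K: "k = 2 * K + 1" by (auto elim: oddE)
    have "v = (2 * K * n + n + 2) * (n + 1)" using k K by (simp add: algebra_simps)
    then show ?thesis using URD_odd_columns[OF n c, of K] by simp
  qed
qed

end
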